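(* Let $f:\mathbb Z^2\to\mathbb{RP}^2$ be a pentagram lattice map, let $g$ be (either one of) its affine coordinates, and let $T$ be the corresponding pentagram map dynamics, with $v$ the associated initial polygon and $u$ its affine coordinate. Consider the square lattice with face weights $(a_{i,j})_{(i,j)\in\mathbb Z^2}$ given by $$a_{i,j}=g_{\frac{i+3j+[i+j]_2}{2},\frac{-i-3j+[i+j]_2}{2}}=\tilde g_{i+3j,[i+j]_2}=\begin{cases}u_{\frac{i+3j}{2}}&\text{if }[i+j]_2=0,\\ T(u)_{\frac{i+3j-1}{2}}&\text{if }[i+j]_2=1.\end{cases}$$ Then, for all $(i,j)\in\mathbb Z^2$ such that $i+j\ge1$, $$g_{i,j}=Y\bigl(A_{i+j-1}[\tilde g_{i-j,[i-j]_2}],a\bigr)=\begin{cases}Y\bigl(A_{i+j-1}[u_{\frac{i-j}{2}}],a\bigr)&\text{if }[i-j]_2=0,\\ Y\bigl(A_{i+j-1}[T(u)_{\frac{i-j-1}{2}}],a\bigr)&\text{if }[i-j]_2=1,\end{cases}$$ where $\tilde g_{i-j,[i-j]_2}=g_{\frac{i-j+[i-j]_2}{2},\frac{-(i-j)+[i-j]_2}{2}}$ and $A_{i+j-1}[\cdot]$ denotes the Aztec diamond $A_{i+j-1}(p,q)$ centered at any face $(p,q)$ with $p+3q=i-j$ (for instance $(i-j,0)$), i.e. a face carrying the label in brackets; since $a$ is invariant under translation by $(3,-1)$, the choice does not matter.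
   Context: $[n]_q\in\{0,\dots,q-1\}$ is the residue of $n$ modulo $q$. For a point $[r]=[r_0,r_1,r_2]\in\mathbb{RP}^2$ and $\ell\in\{0,1\}$, its $\ell$-th affine coordinate is $\pi_\ell([r])=r_\ell/r_2\in\hat{\mathbb R}=\mathbb R\cup\{\infty\}$. Pentagram map: for points $(v_i)_{i\in\mathbb Z}$ in $\mathbb{RP}^2$, $T(v)_i=v_{i-1}v_{i+1}\cap v_iv_{i+2}$, where $v_iv_j$ is the line through $v_i,v_j$. A pentagram lattice map is a family $\tilde f_{i,j}$ ($i+j$ even) of points in $\mathbb{RP}^2$ with $\tilde f_{i,j}=\tilde f_{i-3,j-1}\tilde f_{i+1,j-1}\cap\tilde f_{i-1,j-1}\tilde f_{i+3,j-1}$, or equivalently the map $f_{i,j}=\tilde f_{i-j,i+j}$ on $\mathbb Z^2$. It is identified with the pentagram map through $v_i=\tilde f_{2i,0}$, $T(v)_i=\tilde f_{2i+1,1}$, and more generally $\tilde f_{i,j}=T^j(v)_{(i-j)/2}$. For a fixed $\ell\in\{0,1\}$, $g_{i,j}=\pi_\ell(f_{i,j})$, $\tilde g_{i,j}=\pi_\ell(\tilde f_{i,j})$, $u_i=\pi_\ell(v_i)$, $T(u)_i=\pi_\ell(T(v)_i)$. Ratio function of oriented dimers. Consider the square lattice whose faces are the unit squares centered at the points of $\mathbb Z^2$, face $(i,j)$ carrying the weight $a_{i,j}$. For $k\ge1$, the Aztec diamond $A_k(i,j)$ is the subgraph formed by the vertices and edges of its internal faces, which are the faces $(i',j')$ with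 $|i'-i|+|j'-j|<k$; its open faces are the $(i',j')$ with $|i'-i|+|j'-j|=k$; $F$ is the set of all internal and open faces. The graph is bipartite. A Kasteleyn orientation is a skew-symmetric function $\varphi$ from directed edges to $\{-1,1\}$ such that for every internal face $f$, $\prod_{wb\in\partial f}\varphi_{(w,b)}=-1$ (product over the four boundary edges, each directed from white to black). An oriented dimer configuration $\vec{M}$ is a set of directed edges whose undirected version is a perfect matching (each matched edge carrying exactly one direction). Its weight is $\prod_{\vec e\in\vec M}\varphi_{\vec e}\,a_{f(\vec e)}$, where $f(\vec e)\in F$ is the face to the right of $\vec e$. $Z(A,a,\varphi)$ is the sum of the weights of all oriented dimer configurations of $A$, and $Y(A,a)=\bigl(\prod_{f\in F}a_f\bigr)\frac{Z(A,a^{-1},\varphi)}{Z(A,a,\varphi)}$, where $a^{-1}$ denotes the inverse face weights; this does not depend on $\varphi$. For size $0$, $Y(A_0(i,j),a)=a_{i,j}$. $Y$ is regarded as a rational function of the face weights. Standing assumption: the data are generic, so that all expressions are well defined. *)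

theory Defs
  imports "HOL-Analysis.Analysis"
begin

text \<open>Homogeneous coordinates \<open>[r\<^sub>0, r\<^sub>1, r\<^sub>2]\<close> are the components \<open>r $ 0\<close>, \<open>r $ 1\<close>, \<open>r $ 2\<close>;
  in the index type \<open>3\<close> arithmetic is modulo 3, so \<open>0\<close>, \<open>1\<close>, \<open>2\<close> are its three elements.\<close>

definition proportional :: "real ^ 3 \<Rightarrow> real ^ 3 \<Rightarrow> bool" where
  "proportional x y \<longleftrightarrow> x \<noteq> 0 \<and> y \<noteq> 0 \<and> (\<exists>c. y = c *\<^sub>R x)"

quotient_type rp2 = "real ^ 3" / partial: proportional
proof (rule part_equivpI)
  show "\<exists>x. proportional x x"
    by (rule exI [of _ 1]) (auto simp: proportional_def intro: exI [of _ 1])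
  show "symp proportional"
  proof (rule sympI)
    fix x y assume "proportional x y"
    then obtain c where "x \<noteq> 0" "y \<noteq> 0" "y = c *\<^sub>R x"
      by (auto simp: proportional_def)
    then have "x = inverse c *\<^sub>R y" by auto
    with \<open>x \<noteq> 0\<close> \<open>y \<noteq> 0\<close> show "proportional y x"
      by (auto simp: proportional_def)
  qed
  show "transp proportional"
    by (rule transpI) (auto simp: proportional_def)
qed

text \<open>\<open>\<real> \<union> {\<infinity>}\<close> is represented by \<^typ>\<open>real option\<close>, with \<open>None\<close> for \<open>\<infinity>\<close>.
  The quotient \<open>r\<^sub>l / r\<^sub>2\<close> makes sense in \<open>\<real> \<union> {\<infinity>}\<close> unless \<open>r\<^sub>l = r\<^sub>2 = 0\<close>; at such points
  \<open>has_affine_coord\<close> is false and the value of \<open>affine_coord\<close> is irrelevant.\<close>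

lift_definition affine_coord :: "3 \<Rightarrow> rp2 \<Rightarrow> real option"
  is "\<lambda>l r. if r $ 2 = 0 then None else Some (r $ l / r $ 2)"
  by (auto simp: proportional_def)

lift_definition has_affine_coord :: "3 \<Rightarrow> rp2 \<Rightarrow> bool"
  is "\<lambda>l r. \<not> (r $ l = 0 \<and> r $ 2 = 0)"
  by (auto simp: proportional_def)

text \<open>A line as its set of points; only meaningful for \<open>P \<noteq> Q\<close>.\<close>

definition line_through :: "rp2 \<Rightarrow> rp2 \<Rightarrow> rp2 set" where
  "line_through P Q = {R. rep_rp2 R \<in> span {rep_rp2 P, rep_rp2 Q}}"

definition pentagram_map :: "(int \<Rightarrow> rp2) \<Rightarrow> int \<Rightarrow> rp2" where
  "pentagram_map v i =
     the_elem (line_through (v (i - 1)) (v (i + 1)) \<inter> line_through (v i) (v (i + 2)))"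

text \<open>\<open>tilde f m n\<close> is used for \<open>m + n\<close> even only, where it inverts
  \<open>f i j = tilde f (i - j) (i + j)\<close>.\<close>

definition tilde :: "(int \<Rightarrow> int \<Rightarrow> rp2) \<Rightarrow> int \<Rightarrow> int \<Rightarrow> rp2" where
  "tilde f m n = f ((m + n) div 2) ((n - m) div 2)"

text \<open>The conditions say that both lines are defined and that they meet in exactly one point.\<close>

definition pentagram_lattice_map :: "(int \<Rightarrow> int \<Rightarrow> rp2) \<Rightarrow> bool" where
  "pentagram_lattice_map f \<longleftrightarrow> (\<forall>m n. even (m + n) \<longrightarrow>
     tilde f (m - 3) (n - 1) \<noteq> tilde f (m + 1) (n - 1) \<and>
     tilde f (m - 1) (n - 1) \<noteq> tilde f (m + 3) (n - 1) \<and>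
     line_through (tilde f (m - 3) (n - 1)) (tilde f (m + 1) (n - 1)) \<inter>
     line_through (tilde f (m - 1) (n - 1)) (tilde f (m + 3) (n - 1)) = {tilde f m n})"

definition initial_polygon :: "(int \<Rightarrow> int \<Rightarrow> rp2) \<Rightarrow> int \<Rightarrow> rp2" where
  "initial_polygon f i = tilde f (2 * i) 0"

text \<open>The face \<open>(p, q)\<close> is the unit square centered at \<open>(p, q)\<close>. The pair \<open>(x, y)\<close> encodes the
  vertex at \<open>(x + 1/2, y + 1/2)\<close>.\<close>

type_synonym face = "int \<times> int"
type_synonym vertex = "int \<times> int"
type_synonym dedge = "vertex \<times> vertex"

definition face_vertices :: "face \<Rightarrow> vertex set" where
  "face_vertices = (\<lambda>(p, q). {p - 1, p} \<times> {q - 1, q})"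

definition adjacent :: "vertex \<Rightarrow> vertex \<Rightarrow> bool" where
  "adjacent = (\<lambda>(x, y) (x', y'). \<bar>x - x'\<bar> + \<bar>y - y'\<bar> = 1)"

definition face_dedges :: "face \<Rightarrow> dedge set" where
  "face_dedges c = {(v, w). v \<in> face_vertices c \<and> w \<in> face_vertices c \<and> adjacent v w}"

text \<open>For an edge from \<open>(x, y)\<close> to \<open>(x', y')\<close>: its midpoint \<open>((x + x' + 1)/2, (y + y' + 1)/2)\<close> plus
  half of its direction rotated clockwise by a right angle, that is \<open>(y' - y, x - x')/2\<close>.\<close>

definition right_face :: "dedge \<Rightarrow> face" where
  "right_face = (\<lambda>((x, y), (x', y')).
     ((x + x' + 1 + (y' - y)) div 2, (y + y' + 1 + (x - x')) div 2))"

text \<open>Exchanging the two colours changes neither the Kasteleyn condition nor anything below.\<close>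

definition white :: "vertex \<Rightarrow> bool" where
  "white = (\<lambda>(x, y). even (x + y))"

definition internal_faces :: "nat \<Rightarrow> face \<Rightarrow> face set" where
  "internal_faces k = (\<lambda>(i, j). {(i', j'). \<bar>i' - i\<bar> + \<bar>j' - j\<bar> < int k})"

definition open_faces :: "nat \<Rightarrow> face \<Rightarrow> face set" where
  "open_faces k = (\<lambda>(i, j). {(i', j'). \<bar>i' - i\<bar> + \<bar>j' - j\<bar> = int k})"

definition aztec_faces :: "nat \<Rightarrow> face \<Rightarrow> face set" where
  "aztec_faces k c = internal_faces k c \<union> open_faces k c"

definition aztec_vertices :: "nat \<Rightarrow> face \<Rightarrow> vertex set" where
  "aztec_vertices k c = \<Union> (face_vertices ` internal_faces k c)"

definition aztec_dedges :: "nat \<Rightarrow> face \<Rightarrow> dedge set" where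
  "aztec_dedges k c = \<Union> (face_dedges ` internal_faces k c)"

definition undirected :: "dedge \<Rightarrow> vertex set" where
  "undirected = (\<lambda>(v, w). {v, w})"

definition kasteleyn_orientation :: "nat \<Rightarrow> face \<Rightarrow> (dedge \<Rightarrow> real) \<Rightarrow> bool" where
  "kasteleyn_orientation k c \<phi> \<longleftrightarrow>
     (\<forall>(v, w) \<in> aztec_dedges k c. \<phi> (v, w) \<in> {-1, 1} \<and> \<phi> (w, v) = - \<phi> (v, w)) \<and>
     (\<forall>d \<in> internal_faces k c. (\<Prod>e \<in> {(w, b) \<in> face_dedges d. white w}. \<phi> e) = -1)"

definition perfect_matching :: "nat \<Rightarrow> face \<Rightarrow> vertex set set \<Rightarrow> bool" where
  "perfect_matching k c N \<longleftrightarrow>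
     N \<subseteq> undirected ` aztec_dedges k c \<and> (\<forall>v \<in> aztec_vertices k c. \<exists>!e. e \<in> N \<and> v \<in> e)"

text \<open>Injectivity of \<open>undirected\<close> on \<open>M\<close>: no matched edge occurs in both directions.\<close>

definition oriented_dimers :: "nat \<Rightarrow> face \<Rightarrow> dedge set set" where
  "oriented_dimers k c = {M. M \<subseteq> aztec_dedges k c \<and> inj_on undirected M \<and>
     perfect_matching k c (undirected ` M)}"

definition dimer_Z :: "nat \<Rightarrow> face \<Rightarrow> (face \<Rightarrow> real) \<Rightarrow> (dedge \<Rightarrow> real) \<Rightarrow> real" where
  "dimer_Z k c a \<phi> = (\<Sum>M \<in> oriented_dimers k c. \<Prod>e \<in> M. \<phi> e * a (right_face e))"

text \<open>The value does not depend on the Kasteleyn orientation \<open>\<phi>\<close>, which is kept as an argument and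
  quantified universally where \<open>dimer_Y\<close> is used.\<close>

definition dimer_Y :: "nat \<Rightarrow> face \<Rightarrow> (face \<Rightarrow> real) \<Rightarrow> (dedge \<Rightarrow> real) \<Rightarrow> real" where
  "dimer_Y k c a \<phi> =
     (if k = 0 then a c
      else (\<Prod>d \<in> aztec_faces k c. a d) *
             (dimer_Z k c (\<lambda>d. inverse (a d)) \<phi> / dimer_Z k c a \<phi>))"

end

theory Submission
  imports Defs
begin

text \<open>
  Each line of the pentagram configuration carries two consecutive points of one level and two of the
  next, so the points labelling a face, its four neighbours and the updated face form a complete
  quadrilateral. By Menelaus' theorem every affine coordinate satisfies the dSKP equation.

  The edges of an Aztec diamond of size \<open>k + 1\<close> split into squares around the faces of one parity.
  Complementing in every square the set of its matched corners turns the dimer sum into the one for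
  size \<open>k\<close>, where, up to a gauge at the vertices, the labels of these faces have been updated by the
  dSKP equation and the orientation has changed its sign on horizontal edges. The same holds for the
  inverse labels, and comparing the two prefactors shows that the ratio \<open>Y\<close> is invariant; for \<open>k = 0\<close>
  it is the label itself. No determinants are needed.

  This argument divides by differences of coordinates at all intermediate levels, about which nothing is
  assumed. In homogeneous coordinates the claim is an identity between polynomials in the coordinates of
  the initial polygon, divided by the initial denominators. So one moves the polygon along a line
  towards a polygon inscribed in a parabola, whose orbit is explicit and generic. Along this line all but
  countably many polygons are generic, and the claim follows by continuity.
\<close>

section \<open>Dimer covers of vertex sets\<close>

text \<open>Both directions of a matched edge are summed and the orientation is skew, so an edge
  contributes a sign times the difference of the labels on its two sides. At a square with label c
  and neighbours n, e, s, w the Kasteleyn sign combines the two matchings into, up to sign, delta =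
  (n - c)(s - c) - (c - e)(c - w), the denominator of the dSKP equation. Renewal gives each edge the
  weight of the opposite edge over this sum. In terms of the new label c' the dSKP equation reads (s
  - c) / delta = (c' - n) / ((e - n)(n - w)), and similarly for the other neighbours. So the renewed
  weight is again a difference of labels, and the two factors below it belong to the two ends of the
  edge, which is why a gauge absorbs them. The equation is invariant under inversion of all labels.
  Inversion costs monomials in the labels, at the squares and in the gauge, and that they match the
  product over the faces in \<open>dimer_Y\<close> is a count of incidences in the Aztec
  diamond.\<close>

definition edges_in :: "vertex set \<Rightarrow> dedge set" where
  "edges_in S = {(v, w). v \<in> S \<and> w \<in> S \<and> adjacent v w}"

text \<open>Uniqueness ranges over directed edges, so it also excludes an edge in both directions
  and absorbs the injectivity in \<open>oriented_dimers\<close>.\<close>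

definition dimer_covers :: "vertex set \<Rightarrow> dedge set set" where
  "dimer_covers S = {M. M \<subseteq> edges_in S \<and> (\<forall>v\<in>S. \<exists>!e. e \<in> M \<and> v \<in> undirected e)}"

definition cover_sum :: "vertex set \<Rightarrow> (dedge \<Rightarrow> real) \<Rightarrow> real" where
  "cover_sum S w = (\<Sum>M \<in> dimer_covers S. \<Prod>e\<in>M. w e)"

lemma undirected_eq: "undirected (v, w) = {v, w}"
  by (simp add: undirected_def)

lemma edges_in_undirected: "e \<in> edges_in S \<longleftrightarrow> undirected e \<subseteq> S \<and> adjacent (fst e) (snd e)"
  by (cases e) (auto simp: edges_in_def undirected_def)

lemma finite_edges_in: "finite S \<Longrightarrow> finite (edges_in S)"
  by (rule finite_subset[of _ "S \<times> S"]) (auto simp: edges_in_def)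

lemma edges_in_mono: "S \<subseteq> T \<Longrightarrow> edges_in S \<subseteq> edges_in T"
  by (auto simp: edges_in_def)

lemma finite_dimer_covers: "finite S \<Longrightarrow> finite (dimer_covers S)"
  by (rule finite_subset[of _ "Pow (edges_in S)"]) (auto simp: dimer_covers_def finite_edges_in)

lemma finite_dimer_cover: "finite S \<Longrightarrow> M \<in> dimer_covers S \<Longrightarrow> finite M"
  by (auto simp: dimer_covers_def intro: finite_subset finite_edges_in)

lemma dimer_covers_unique:
  "M \<in> dimer_covers S \<Longrightarrow> e \<in> M \<Longrightarrow> e' \<in> M \<Longrightarrow> v \<in> undirected e \<Longrightarrow> v \<in> undirected e' \<Longrightarrow> e = e'"
  by (fastforce simp: dimer_covers_def edges_in_undirected)

lemma dimer_coversI: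
  assumes "M \<subseteq> edges_in S" "\<And>v. v \<in> S \<Longrightarrow> \<exists>e\<in>M. v \<in> undirected e"
    "\<And>e e' v. e \<in> M \<Longrightarrow> e' \<in> M \<Longrightarrow> v \<in> undirected e \<Longrightarrow> v \<in> undirected e' \<Longrightarrow> e = e'"
  shows "M \<in> dimer_covers S"
  unfolding dimer_covers_def
proof (intro CollectI conjI ballI)
  fix v assume "v \<in> S"
  then obtain e where "e \<in> M" "v \<in> undirected e" using assms(2) by blast
  then show "\<exists>!e. e \<in> M \<and> v \<in> undirected e" using assms(3) by blast
qed (rule assms(1))

lemma dimer_coversD:
  assumes "M \<in> dimer_covers S"
  shows "M \<subseteq> edges_in S" "\<And>v. v \<in> S \<Longrightarrow> \<exists>e\<in>M. v \<in> undirected e"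
  using assms unfolding dimer_covers_def by blast+

lemma dimer_covers_empty: "dimer_covers {} = {{}}"
  by (auto simp: dimer_covers_def edges_in_def)

lemma cover_sum_empty: "cover_sum {} w = 1"
  by (simp add: cover_sum_def dimer_covers_empty)

lemma dimer_covers_remove:
  assumes "M \<in> dimer_covers S" "e \<in> M"
  shows "M - {e} \<in> dimer_covers (S - undirected e)"
proof (rule dimer_coversI)
  show "M - {e} \<subseteq> edges_in (S - undirected e)"
  proof
    fix d assume d: "d \<in> M - {e}"
    then have "undirected d \<inter> undirected e = {}"
      using dimer_covers_unique[OF assms(1)] assms(2) by blast
    then show "d \<in> edges_in (S - undirected e)"
      using d dimer_coversD(1)[OF assms(1)] by (auto simp: edges_in_undirected dest!: subsetD)
  qed
  show "\<And>v. v \<in> S - undirected e \<Longrightarrow> \<exists>e\<in>M - {e}. v \<in> undirected e"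
    using dimer_coversD(2)[OF assms(1)] by blast
qed (use dimer_covers_unique[OF assms(1)] in blast)

lemma dimer_covers_add:
  assumes "M \<in> dimer_covers (S - undirected e)" "e \<in> edges_in S"
  shows "insert e M \<in> dimer_covers S" "e \<notin> M"
proof -
  have M: "d \<in> edges_in S" "undirected d \<inter> undirected e = {}" if "d \<in> M" for d
    using dimer_coversD(1)[OF assms(1)] that by (auto simp: edges_in_undirected dest!: subsetD)
  show "insert e M \<in> dimer_covers S"
  proof (rule dimer_coversI)
    show "insert e M \<subseteq> edges_in S" using M assms(2) by auto
    show "\<And>v. v \<in> S \<Longrightarrow> \<exists>e\<in>insert e M. v \<in> undirected e"
      using dimer_coversD(2)[OF assms(1)] by blast
  next
    fix d d' v
    assume *: "d \<in> insert e M" "d' \<in> insert e M" "v \<in> undirected d" "v \<in> undirected d'"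
    then show "d = d'" using dimer_covers_unique[OF assms(1), of d d' v] M(2) by blast
  qed
  show "e \<notin> M" using M(2)[of e] by (cases e) (auto simp: undirected_def)
qed

lemma cover_sum_expand:
  assumes S: "finite S" and v: "v \<in> S"
  shows "cover_sum S w = (\<Sum>e | e \<in> edges_in S \<and> v \<in> undirected e. w e * cover_sum (S - undirected e) w)"
proof -
  let ?E = "{e. e \<in> edges_in S \<and> v \<in> undirected e}"
  let ?P = "SIGMA e:?E. dimer_covers (S - undirected e)"
  have [simp]: "finite ?E" by (rule finite_subset[OF _ finite_edges_in[OF S]]) auto
  define ed where "ed M = (THE e. e \<in> M \<and> v \<in> undirected e)" for M
  have ed: "ed M \<in> M \<and> v \<in> undirected (ed M)" if "M \<in> dimer_covers S" for M
    unfolding ed_def by (rule theI') (use that v in \<open>auto simp: dimer_covers_def\<close>)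
  have ed_eq: "ed M = e" if "M \<in> dimer_covers S" "e \<in> M" "v \<in> undirected e" for M e
    using dimer_covers_unique[OF that(1)] ed that by blast
  have "cover_sum S w = (\<Sum>(e, M) \<in> ?P. w e * (\<Prod>d\<in>M. w d))"
    unfolding cover_sum_def
  proof (rule sum.reindex_bij_witness[where i = "\<lambda>(e, M). insert e M" and j = "\<lambda>M. (ed M, M - {ed M})"])
    fix M assume M: "M \<in> dimer_covers S"
    show "(case (ed M, M - {ed M}) of (e, M) \<Rightarrow> insert e M) = M" using ed[OF M] by auto
    show "(ed M, M - {ed M}) \<in> ?P"
      using ed[OF M] dimer_covers_remove[OF M] dimer_coversD(1)[OF M] by auto
    show "(case (ed M, M - {ed M}) of (e, M) \<Rightarrow> w e * (\<Prod>d\<in>M. w d)) = prod w M"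
      using ed[OF M] finite_dimer_cover[OF S M] by (simp add: prod.remove[of M "ed M"])
  next
    fix b assume "b \<in> ?P"
    then obtain e M where b: "b = (e, M)" "e \<in> edges_in S" "v \<in> undirected e"
      "M \<in> dimer_covers (S - undirected e)" by auto
    note a = dimer_covers_add[OF b(4,2)]
    show "(case b of (e, M) \<Rightarrow> insert e M) \<in> dimer_covers S" using a b by simp
    have "ed (insert e M) = e" using ed_eq[OF a(1)] b by simp
    then show "(ed (case b of (e, M) \<Rightarrow> insert e M),
          (case b of (e, M) \<Rightarrow> insert e M) - {ed (case b of (e, M) \<Rightarrow> insert e M)}) = b"
      using a b by simp
  qed
  also have "\<dots> = (\<Sum>e\<in>?E. w e * cover_sum (S - undirected e) w)"
    by (subst sum.Sigma[symmetric])
      (use S in \<open>auto simp: finite_dimer_covers cover_sum_def sum_distrib_left\<close>)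
  finally show ?thesis .
qed

lemma cover_sum_insert:
  assumes S: "finite S" and v: "v \<notin> S"
  shows "cover_sum (insert v S) w
    = (\<Sum>u | u \<in> S \<and> adjacent v u. (w (v, u) + w (u, v)) * cover_sum (S - {u}) w)"
proof -
  let ?U = "{u. u \<in> S \<and> adjacent v u}"
  have adj: "adjacent x y \<longleftrightarrow> adjacent y x" "\<not> adjacent x x" for x y
    by (auto simp: adjacent_def split: prod.splits)
  have fin: "finite ?U" using S by auto
  have E: "{e. e \<in> edges_in (insert v S) \<and> v \<in> undirected e} = Pair v ` ?U \<union> (\<lambda>u. (u, v)) ` ?U"
    using adj by (auto simp: edges_in_def undirected_def)
  have D: "insert v S - undirected (v, u) = S - {u}" "insert v S - undirected (u, v) = S - {u}" for u
    using v by (auto simp: undirected_def)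
  have "cover_sum (insert v S) w
      = (\<Sum>e \<in> Pair v ` ?U \<union> (\<lambda>u. (u, v)) ` ?U. w e * cover_sum (insert v S - undirected e) w)"
    by (subst cover_sum_expand[of _ v]) (use S E in auto)
  also have "\<dots> = (\<Sum>u\<in>?U. w (v, u) * cover_sum (S - {u}) w) + (\<Sum>u\<in>?U. w (u, v) * cover_sum (S - {u}) w)"
    by (subst sum.union_disjoint) (use fin v in \<open>auto simp: sum.reindex inj_on_def D\<close>)
  finally show ?thesis by (simp add: sum.distrib distrib_right)
qed

text \<open>Every cover meets every vertex exactly once, so the factors at the ends of its edges
  multiply to the product over \<open>S\<close>. Only the sums over the two directions of an edge
  are compared, which rules out a comparison of directed covers term by term; hence the induction
  along vertex expansions.\<close>

lemma cover_sum_gauge: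
  assumes S: "finite S" and w: "\<And>u v. (u, v) \<in> edges_in S \<Longrightarrow> w' (u, v) + w' (v, u) = g u * g v * (w (u, v) + w (v, u))"
  shows "cover_sum S w' = (\<Prod>v\<in>S. g v) * cover_sum S w"
  using assms
proof (induction "card S" arbitrary: S rule: less_induct)
  case less
  show ?case
  proof (cases "S = {}")
    case False
    then obtain v T where T: "S = insert v T" "v \<notin> T" by (meson Set.set_insert ex_in_conv)
    have fT: "finite T" using T less.prems by auto
    have "cover_sum S w' = (\<Sum>u | u \<in> T \<and> adjacent v u. (w' (v, u) + w' (u, v)) * cover_sum (T - {u}) w')"
      using cover_sum_insert[OF fT T(2)] T by simp
    also have "\<dots> = (\<Sum>u | u \<in> T \<and> adjacent v u. (\<Prod>v\<in>S. g v) * ((w (v, u) + w (u, v)) * cover_sum (T - {u}) w))"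
    proof (rule sum.cong[OF refl])
      fix u assume u: "u \<in> {u. u \<in> T \<and> adjacent v u}"
      have "cover_sum (T - {u}) w' = (\<Prod>v\<in>T - {u}. g v) * cover_sum (T - {u}) w"
      proof (rule less.hyps)
        show "card (T - {u}) < card S" using T fT u by (simp add: card_Diff1_le le_imp_less_Suc)
        show "w' (x, y) + w' (y, x) = g x * g y * (w (x, y) + w (y, x))" if "(x, y) \<in> edges_in (T - {u})" for x y
          using less.prems(2) that T(1) by (auto simp: edges_in_def)
      qed (use fT in auto)
      moreover have "w' (v, u) + w' (u, v) = g v * g u * (w (v, u) + w (u, v))"
        using less.prems(2) u T(1) by (auto simp: edges_in_def)
      moreover have "(\<Prod>v\<in>S. g v) = g v * (g u * (\<Prod>v\<in>T - {u}. g v))"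
        using T fT u by (simp add: prod.remove[of T u])
      ultimately show "(w' (v, u) + w' (u, v)) * cover_sum (T - {u}) w' =
          (\<Prod>v\<in>S. g v) * ((w (v, u) + w (u, v)) * cover_sum (T - {u}) w)" by simp
    qed
    also have "\<dots> = (\<Prod>v\<in>S. g v) * cover_sum S w"
      unfolding T(1) by (subst cover_sum_insert[OF fT T(2)]) (simp add: sum_distrib_left)
    finally show ?thesis .
  qed (simp add: cover_sum_empty)
qed

section \<open>Splitting covers along squares that partition the edges\<close>

definition cell_splits :: "face set \<Rightarrow> vertex set \<Rightarrow> (face \<Rightarrow> vertex set) set" where
  "cell_splits I S = {T \<in> (\<Pi>\<^sub>E C\<in>I. Pow (face_vertices C)).
     (\<forall>C\<in>I. T C \<subseteq> S) \<and> (\<forall>v\<in>S. \<exists>!C. C \<in> I \<and> v \<in> T C)}"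

lemma finite_face_vertices: "finite (face_vertices C)"
  by (cases C) (auto simp: face_vertices_def)

lemma undirected_nonempty: "undirected e \<noteq> {}"
  by (cases e) (auto simp: undirected_def)

text \<open>Each edge lies in exactly one cell, so a cover amounts to the choice of the set
  \<open>T C\<close> of vertices matched inside each cell \<open>C\<close>, followed by independent
  covers of these sets. Extensionality of the functions makes this a bijection.\<close>

lemma cover_sum_cells:
  assumes S: "finite S" and I: "finite I"
    and cell: "\<And>e. e \<in> edges_in S \<Longrightarrow> \<exists>!C. C \<in> I \<and> undirected e \<subseteq> face_vertices C"
  shows "cover_sum S w = (\<Sum>T\<in>cell_splits I S. \<Prod>C\<in>I. cover_sum (T C) w)"
proof -
  let ?P = "SIGMA T:cell_splits I S. \<Pi>\<^sub>E C\<in>I. dimer_covers (T C)"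
  let ?in = "\<lambda>M C. {e \<in> M. undirected e \<subseteq> face_vertices C}"
  let ?j = "\<lambda>M. (\<lambda>C\<in>I. \<Union> (undirected ` ?in M C), \<lambda>C\<in>I. ?in M C)"
  have fin_split: "finite (cell_splits I S)"
    by (rule finite_subset[of _ "\<Pi>\<^sub>E C\<in>I. Pow (face_vertices C)"])
      (auto simp: cell_splits_def I finite_face_vertices intro!: finite_PiE)
  have fin_T: "finite (T C)" if "T \<in> cell_splits I S" "C \<in> I" for T C
    using that S unfolding cell_splits_def by (auto intro: finite_subset[of _ S])
  have "(\<Sum>T\<in>cell_splits I S. \<Prod>C\<in>I. cover_sum (T C) w)
      = (\<Sum>T\<in>cell_splits I S. \<Sum>m \<in> (\<Pi>\<^sub>E C\<in>I. dimer_covers (T C)). \<Prod>C\<in>I. prod w (m C))"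
    unfolding cover_sum_def
    by (intro sum.cong refl prod_sum_PiE I finite_dimer_covers fin_T)
  also have "\<dots> = (\<Sum>(T, m)\<in>?P. \<Prod>C\<in>I. prod w (m C))"
    by (rule sum.Sigma) (use fin_split I fin_T in \<open>auto intro!: finite_PiE finite_dimer_covers\<close>)
  also have "\<dots> = (\<Sum>M\<in>dimer_covers S. prod w M)"
  proof (rule sum.reindex_bij_witness[where j = "\<lambda>(T, m). \<Union>C\<in>I. m C" and i = ?j])
    fix M assume M: "M \<in> dimer_covers S"
    have cellM: "\<exists>!C. C \<in> I \<and> undirected e \<subseteq> face_vertices C" if "e \<in> M" for e
      using cell dimer_coversD(1)[OF M] that by blast
    have uM: "undirected e \<subseteq> S" if "e \<in> M" for e
      using dimer_coversD(1)[OF M] that by (auto simp: edges_in_undirected dest!: subsetD)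
    show "(case ?j M of (T, m) \<Rightarrow> \<Union>C\<in>I. m C) = M"
    proof (intro set_eqI iffI)
      fix e assume "e \<in> M"
      then show "e \<in> (case ?j M of (T, m) \<Rightarrow> \<Union>C\<in>I. m C)" using cellM[of e] by force
    qed (auto split: if_splits)
    have "(\<lambda>C\<in>I. \<Union> (undirected ` ?in M C)) \<in> cell_splits I S"
      unfolding cell_splits_def
    proof (intro CollectI conjI ballI)
      fix v assume v: "v \<in> S"
      then obtain e where e: "e \<in> M" "v \<in> undirected e" using dimer_coversD(2)[OF M] by blast
      obtain C where C: "C \<in> I" "undirected e \<subseteq> face_vertices C" using cellM[OF e(1)] by blast
      show "\<exists>!C. C \<in> I \<and> v \<in> (\<lambda>C\<in>I. \<Union> (undirected ` ?in M C)) C"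
      proof (rule ex1I[of _ C])
        show "C \<in> I \<and> v \<in> (\<lambda>C\<in>I. \<Union> (undirected ` ?in M C)) C"
          using e C by (force simp del: split_paired_Ex)
        fix C' assume C': "C' \<in> I \<and> v \<in> (\<lambda>C\<in>I. \<Union> (undirected ` ?in M C)) C'"
        then obtain e' where e': "e' \<in> M" "undirected e' \<subseteq> face_vertices C'" "v \<in> undirected e'" by auto
        have "e' = e" using dimer_covers_unique[OF M e'(1) e(1) e'(3) e(2)] .
        then show "C' = C" using cellM[OF e(1)] C C' e' by blast
      qed
    next
      fix C assume "C \<in> I"
      then show "(\<lambda>C\<in>I. \<Union> (undirected ` ?in M C)) C \<subseteq> S" using uM by fastforce
    qed auto
    moreover have "?in M C \<in> dimer_covers (\<Union> (undirected ` ?in M C))" for C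
    proof (rule dimer_coversI)
      show "?in M C \<subseteq> edges_in (\<Union> (undirected ` ?in M C))"
      proof
        fix e assume e: "e \<in> ?in M C"
        then have "adjacent (fst e) (snd e)" using dimer_coversD(1)[OF M] edges_in_undirected by blast
        then show "e \<in> edges_in (\<Union> (undirected ` ?in M C))" using e unfolding edges_in_undirected by blast
      qed
    qed (use dimer_covers_unique[OF M] in auto)
    ultimately show "?j M \<in> ?P" by auto
  next
    fix b assume "b \<in> ?P"
    then obtain T m where b: "b = (T, m)" "T \<in> cell_splits I S" "m \<in> (\<Pi>\<^sub>E C\<in>I. dimer_covers (T C))"
      by auto
    have m: "m C \<in> dimer_covers (T C)" if "C \<in> I" for C using b that by auto
    have TS: "T C \<subseteq> S" "T C \<subseteq> face_vertices C" if "C \<in> I" for C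
      using b(2) that by (auto simp: cell_splits_def)
    have T1: "\<exists>!C. C \<in> I \<and> v \<in> T C" if "v \<in> S" for v
      using b(2) that by (auto simp: cell_splits_def)
    have me: "undirected e \<subseteq> T C" "e \<in> edges_in S" if "C \<in> I" "e \<in> m C" for C e
      using subsetD[OF dimer_coversD(1)[OF m[OF that(1)]] that(2)] TS(1)[OF that(1)]
      unfolding edges_in_undirected by blast+
    have uniq: "C = C'" if "C \<in> I" "C' \<in> I" "e \<in> m C" "e' \<in> m C'" "v \<in> undirected e" "v \<in> undirected e'"
      for C C' e e' v
    proof -
      have "v \<in> T C" "v \<in> T C'" using me(1)[OF that(1,3)] me(1)[OF that(2,4)] that(5,6) by auto
      moreover from this have "v \<in> S" using TS(1)[OF that(1)] by auto
      ultimately show ?thesis using T1[of v] that(1,2) by blast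
    qed
    have cov: "(\<Union>C\<in>I. m C) \<in> dimer_covers S"
    proof (rule dimer_coversI)
      show "(\<Union>C\<in>I. m C) \<subseteq> edges_in S" using me by auto
      show "\<exists>e\<in>\<Union>C\<in>I. m C. v \<in> undirected e" if v: "v \<in> S" for v
      proof -
        obtain C where "C \<in> I" "v \<in> T C" using T1[OF v] by blast
        then show ?thesis using dimer_coversD(2)[OF m[of C]] by blast
      qed
      fix e e' v
      assume *: "e \<in> (\<Union>C\<in>I. m C)" "e' \<in> (\<Union>C\<in>I. m C)" "v \<in> undirected e" "v \<in> undirected e'"
      then obtain C C' where C: "C \<in> I" "e \<in> m C" "C' \<in> I" "e' \<in> m C'" by auto
      then have "C = C'" using uniq[of C C' e e' v] * by simp
      then show "e = e'" using dimer_covers_unique[OF m[OF C(1)], of e e' v] C * by simp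
    qed
    have in_eq: "?in (\<Union>C\<in>I. m C) C = m C" if C: "C \<in> I" for C
    proof (intro set_eqI iffI)
      fix e assume "e \<in> ?in (\<Union>C\<in>I. m C) C"
      then obtain C' where C': "C' \<in> I" "e \<in> m C'" "undirected e \<subseteq> face_vertices C" by auto
      moreover have "undirected e \<subseteq> face_vertices C'" using me(1)[OF C'(1,2)] TS(2)[OF C'(1)] by blast
      ultimately have "C = C'" using cell[OF me(2)[OF C'(1,2)]] C by blast
      then show "e \<in> m C" using C' by simp
    next
      fix e assume "e \<in> m C"
      then show "e \<in> ?in (\<Union>C\<in>I. m C) C" using C me(1)[OF C] TS(2)[OF C] by blast
    qed
    have T_eq: "\<Union> (undirected ` m C) = T C" if C: "C \<in> I" for C
      using me(1)[OF C] dimer_coversD(2)[OF m[OF C]] by blast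
    show "(case b of (T, m) \<Rightarrow> \<Union>C\<in>I. m C) \<in> dimer_covers S" using cov b by simp
    have "(\<lambda>C\<in>I. \<Union> (undirected ` ?in (\<Union>C\<in>I. m C) C)) = T"
    proof
      fix C show "(\<lambda>C\<in>I. \<Union> (undirected ` ?in (\<Union>C\<in>I. m C) C)) C = T C"
        using b(2) in_eq[of C] T_eq[of C] PiE_arb[of T I "\<lambda>C. Pow (face_vertices C)" C]
        by (cases "C \<in> I") (simp_all add: cell_splits_def)
    qed
    moreover have "(\<lambda>C\<in>I. ?in (\<Union>C\<in>I. m C) C) = m"
    proof
      fix C show "(\<lambda>C\<in>I. ?in (\<Union>C\<in>I. m C) C) C = m C"
        using in_eq[of C] PiE_arb[OF b(3), of C] by (cases "C \<in> I") simp_all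
    qed
    ultimately show "?j (case b of (T, m) \<Rightarrow> \<Union>C\<in>I. m C) = b" using b by simp
    have "prod w (\<Union>C\<in>I. m C) = (\<Prod>C\<in>I. prod w (m C))"
    proof (rule prod.UNION_disjoint[OF I])
      show "\<forall>C\<in>I. finite (m C)" using finite_dimer_cover[OF fin_T[OF b(2)] m] by blast
      show "\<forall>C\<in>I. \<forall>C'\<in>I. C \<noteq> C' \<longrightarrow> m C \<inter> m C' = {}"
      proof (intro ballI impI equals0I)
        fix C C' e assume "C \<in> I" "C' \<in> I" "C \<noteq> C'" "e \<in> m C \<inter> m C'"
        moreover obtain v where "v \<in> undirected e" using undirected_nonempty by blast
        ultimately show False using uniq[of C C' e e v] by simp
      qed
    qed
    then show "prod w (case b of (T, m) \<Rightarrow> \<Union>C\<in>I. m C) = (case b of (T, m) \<Rightarrow> \<Prod>C\<in>I. prod w (m C))"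
      using b by simp
  qed
  finally show ?thesis by (simp add: cover_sum_def)
qed

section \<open>Dimer sums of a single square\<close>

definition edge_sum :: "(dedge \<Rightarrow> real) \<Rightarrow> vertex \<Rightarrow> vertex \<Rightarrow> real" where
  "edge_sum w u v = w (u, v) + w (v, u)"

text \<open>The vertex \<open>(x, y)\<close> is the upper right corner of the face
  \<open>(x, y)\<close>, so the two terms are the two perfect matchings of the boundary: both
  horizontal edges or both vertical ones.\<close>

definition cell_sum :: "(dedge \<Rightarrow> real) \<Rightarrow> face \<Rightarrow> real" where
  "cell_sum w = (\<lambda>(x, y). edge_sum w (x, y) (x - 1, y) * edge_sum w (x - 1, y - 1) (x, y - 1)
     + edge_sum w (x, y) (x, y - 1) * edge_sum w (x - 1, y - 1) (x - 1, y))"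

lemma edge_sum_commute: "edge_sum w u v = edge_sum w v u"
  by (simp add: edge_sum_def)

lemma cover_sum_insert':
  assumes "finite S" and "v \<notin> S"
  shows "cover_sum (insert v S) w = (\<Sum>u\<in>S. if adjacent v u then edge_sum w v u * cover_sum (S - {u}) w else 0)"
  unfolding edge_sum_def by (simp add: cover_sum_insert[OF assms] sum.inter_filter[OF assms(1)])

lemma cover_sum_singleton: "cover_sum {a} w = 0"
  by (simp add: cover_sum_insert')

lemma cover_sum_pair: "a \<noteq> b \<Longrightarrow> cover_sum {a, b} w = (if adjacent a b then edge_sum w a b else 0)"
  by (simp add: cover_sum_insert' cover_sum_empty)

lemma cover_sum_triple: "a \<noteq> b \<Longrightarrow> a \<noteq> c \<Longrightarrow> b \<noteq> c \<Longrightarrow> cover_sum {a, b, c} w = 0"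
  by (simp add: cover_sum_insert'[of "{b, c}"] insert_Diff_if cover_sum_singleton)

lemma cover_sum_quadruple:
  assumes "a \<noteq> b" "a \<noteq> c" "a \<noteq> d" "b \<noteq> c" "b \<noteq> d" "c \<noteq> d"
  shows "cover_sum {a, b, c, d} w
    = (if adjacent a b then edge_sum w a b * cover_sum {c, d} w else 0)
    + (if adjacent a c then edge_sum w a c * cover_sum {b, d} w else 0)
    + (if adjacent a d then edge_sum w a d * cover_sum {b, c} w else 0)"
  using assms by (simp add: cover_sum_insert'[of "{b, c, d}"] insert_Diff_if)

lemma cover_sum_square:
  assumes "adjacent a b" "adjacent b a" "adjacent b c" "adjacent c b"
    "adjacent c d" "adjacent d c" "adjacent d a" "adjacent a d"
    "\<not> adjacent a c" "\<not> adjacent c a" "\<not> adjacent b d" "\<not> adjacent d b"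
    and "a \<noteq> b" "a \<noteq> c" "a \<noteq> d" "b \<noteq> c" "b \<noteq> d" "c \<noteq> d"
  shows "cover_sum {a} w = 0" "cover_sum {b} w = 0" "cover_sum {c} w = 0" "cover_sum {d} w = 0"
    "cover_sum {a, b} w = edge_sum w a b" "cover_sum {b, c} w = edge_sum w b c"
    "cover_sum {c, d} w = edge_sum w c d" "cover_sum {a, d} w = edge_sum w a d"
    "cover_sum {a, c} w = 0" "cover_sum {b, d} w = 0"
    "cover_sum {a, b, c} w = 0" "cover_sum {a, b, d} w = 0"
    "cover_sum {a, c, d} w = 0" "cover_sum {b, c, d} w = 0"
    "cover_sum {a, b, c, d} w = edge_sum w a b * edge_sum w c d + edge_sum w a d * edge_sum w b c"
  using assms
  by (simp_all add: cover_sum_singleton cover_sum_pair cover_sum_triple cover_sum_quadruple)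

text \<open>Urban renewal in one square. Single corners, triples and diagonals have no cover, and
  neither have their complements. A side is exchanged with the opposite side. The dual sum of the
  full square is the inverse of \<open>cell_sum\<close>, which settles the empty and the full set.
  The factor is the same for all sixteen subsets, and this is what allows all squares to be
  complemented at once.\<close>

lemma cover_sum_square_dual:
  fixes x y :: int
  assumes T: "T \<subseteq> face_vertices (x, y)" and D: "cell_sum w (x, y) \<noteq> 0"
    and w': "edge_sum w' (x, y) (x - 1, y) = edge_sum w (x - 1, y - 1) (x, y - 1) / cell_sum w (x, y)"
      "edge_sum w' (x - 1, y - 1) (x, y - 1) = edge_sum w (x, y) (x - 1, y) / cell_sum w (x, y)"
      "edge_sum w' (x, y) (x, y - 1) = edge_sum w (x - 1, y - 1) (x - 1, y) / cell_sum w (x, y)"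
      "edge_sum w' (x - 1, y - 1) (x - 1, y) = edge_sum w (x, y) (x, y - 1) / cell_sum w (x, y)"
  shows "cover_sum T w = cell_sum w (x, y) * cover_sum (face_vertices (x, y) - T) w'"
proof -
  let ?a = "(x, y)" and ?b = "(x - 1, y)" and ?c = "(x - 1, y - 1)" and ?d = "(x, y - 1)"
  have F: "face_vertices (x, y) = {?a, ?b, ?c, ?d}" by (auto simp: face_vertices_def)
  obtain a b c d where abcd: "a = ?a" "b = ?b" "c = ?c" "d = ?d" by simp
  have adj: "adjacent a b" "adjacent b a" "adjacent b c" "adjacent c b"
    "adjacent c d" "adjacent d c" "adjacent d a" "adjacent a d"
    "\<not> adjacent a c" "\<not> adjacent c a" "\<not> adjacent b d" "\<not> adjacent d b"
    and ne: "a \<noteq> b" "a \<noteq> c" "a \<noteq> d" "b \<noteq> c" "b \<noteq> d" "c \<noteq> d"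
    by (simp_all add: abcd adjacent_def)
  note sq = cover_sum_square[OF adj ne]
  define \<Delta> where "\<Delta> = cell_sum w (x, y)"
  have \<Delta>: "\<Delta> = edge_sum w a b * edge_sum w c d + edge_sum w a d * edge_sum w b c"
    by (simp add: \<Delta>_def cell_sum_def abcd edge_sum_commute)
  have w'2: "edge_sum w' a b = edge_sum w c d / \<Delta>" "edge_sum w' c d = edge_sum w a b / \<Delta>"
    "edge_sum w' a d = edge_sum w b c / \<Delta>" "edge_sum w' b c = edge_sum w a d / \<Delta>"
    using w' by (simp_all add: abcd \<Delta>_def edge_sum_commute)
  have D': "\<Delta> \<noteq> 0" using D by (simp add: \<Delta>_def)
  have full: "\<Delta> * (edge_sum w c d * edge_sum w a b / (\<Delta> * \<Delta>) + edge_sum w b c * edge_sum w a d / (\<Delta> * \<Delta>)) = 1"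
  proof -
    have "edge_sum w c d * edge_sum w a b / (\<Delta> * \<Delta>) + edge_sum w b c * edge_sum w a d / (\<Delta> * \<Delta>)
        = \<Delta> / (\<Delta> * \<Delta>)"
      by (simp add: \<Delta> add_divide_distrib mult.commute)
    then show ?thesis using D' by simp
  qed
  have "cover_sum ({a, b, c, d} \<inter> T) w = \<Delta> * cover_sum ({a, b, c, d} - T) w'"
    using ne D'
    by (cases "a \<in> T"; cases "b \<in> T"; cases "c \<in> T"; cases "d \<in> T")
      (simp_all add: Int_insert_left insert_Diff_if sq cover_sum_empty w'2(1-4) full flip: \<Delta>)
  moreover have "{a, b, c, d} \<inter> T = T" using T F abcd by auto
  ultimately show ?thesis by (simp add: F abcd \<Delta>_def)
qed

section \<open>Aztec diamonds\<close>

text \<open>\<open>A v\<close> and \<open>B v\<close> are the only possible cells at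
  \<open>v\<close>; \<open>S\<close> asks for one of them to be present, \<open>S'\<close> for both.
  Lying in exactly one of two sets is preserved when both are complemented. A vertex with a single
  cell must be matched there, so it disappears from the complement, and reappears on the way
  back.\<close>

lemma cell_splits_complement:
  assumes AB: "\<And>v C. C \<in> I \<Longrightarrow> v \<in> face_vertices C \<longleftrightarrow> C = A v \<or> C = B v" "\<And>v. A v \<noteq> B v"
    and S: "\<And>v. v \<in> S \<longleftrightarrow> A v \<in> I \<or> B v \<in> I"
    and S': "\<And>v. v \<in> S' \<longleftrightarrow> A v \<in> I \<and> B v \<in> I"
  shows "T \<in> cell_splits I S \<Longrightarrow> (\<lambda>C\<in>I. face_vertices C - T C) \<in> cell_splits I S'"
    and "T \<in> cell_splits I S' \<Longrightarrow> (\<lambda>C\<in>I. face_vertices C - T C) \<in> cell_splits I S"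
proof -
  have mem: "C \<in> I \<and> v \<in> (\<lambda>C\<in>I. face_vertices C - T C) C \<longleftrightarrow> C \<in> I \<and> (C = A v \<or> C = B v) \<and> v \<notin> T C"
    for C v T using AB(1)[of C v] by auto
  {
    assume T: "T \<in> cell_splits I S"
    have TV: "C = A v \<or> C = B v" if "C \<in> I" "v \<in> T C" for v C
      using AB(1)[OF that(1), of v] T that by (auto simp: cell_splits_def)
    have T1: "\<exists>!C. C \<in> I \<and> v \<in> T C" if "v \<in> S" for v
      using T that by (auto simp: cell_splits_def)
    show "(\<lambda>C\<in>I. face_vertices C - T C) \<in> cell_splits I S'"
      unfolding cell_splits_def
    proof (intro CollectI conjI ballI)
      show "(\<lambda>C\<in>I. face_vertices C - T C) \<in> (\<Pi>\<^sub>E C\<in>I. Pow (face_vertices C))" by auto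
      fix C assume C: "C \<in> I"
      show "(\<lambda>C\<in>I. face_vertices C - T C) C \<subseteq> S'"
      proof
        fix v assume "v \<in> (\<lambda>C\<in>I. face_vertices C - T C) C"
        then have v: "C = A v \<or> C = B v" "v \<notin> T C" using C AB(1)[OF C, of v] by auto
        then have "v \<in> S" using S[of v] C by auto
        then obtain C' where "C' \<in> I" "v \<in> T C'" using T1 by blast
        with v C TV[of C' v] show "v \<in> S'" using S'[of v] by metis
      qed
    next
      fix v assume "v \<in> S'"
      then have v: "A v \<in> I" "B v \<in> I" "v \<in> S" using S'[of v] S[of v] by auto
      then have "(v \<in> T (A v)) \<noteq> (v \<in> T (B v))"
        using T1[of v] TV[of _ v] AB(2)[of v] by metis
      then show "\<exists>!C. C \<in> I \<and> v \<in> (\<lambda>C\<in>I. face_vertices C - T C) C"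
        using v AB(2)[of v] unfolding mem by metis
    qed
  next
    assume T: "T \<in> cell_splits I S'"
    have TV: "C = A v \<or> C = B v" "v \<in> S'" if "C \<in> I" "v \<in> T C" for v C
      using AB(1)[OF that(1), of v] T that by (auto simp: cell_splits_def)
    have T1: "\<exists>!C. C \<in> I \<and> v \<in> T C" if "v \<in> S'" for v
      using T that by (auto simp: cell_splits_def)
    show "(\<lambda>C\<in>I. face_vertices C - T C) \<in> cell_splits I S"
      unfolding cell_splits_def
    proof (intro CollectI conjI ballI)
      show "(\<lambda>C\<in>I. face_vertices C - T C) \<in> (\<Pi>\<^sub>E C\<in>I. Pow (face_vertices C))" by auto
      fix C assume C: "C \<in> I"
      show "(\<lambda>C\<in>I. face_vertices C - T C) C \<subseteq> S"
        using C AB(1)[OF C] S by auto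
    next
      fix v assume "v \<in> S"
      then consider "v \<in> S'" "A v \<in> I" "B v \<in> I" | "v \<notin> S'" "A v \<in> I" "B v \<notin> I" | "v \<notin> S'" "A v \<notin> I" "B v \<in> I"
        using S[of v] S'[of v] by auto
      then show "\<exists>!C. C \<in> I \<and> v \<in> (\<lambda>C\<in>I. face_vertices C - T C) C"
      proof cases
        case 1
        then have "(v \<in> T (A v)) \<noteq> (v \<in> T (B v))"
          using T1[of v] TV[of _ v] AB(2)[of v] by metis
        then show ?thesis using 1 AB(2)[of v] unfolding mem by metis
      next
        case 2
        then show ?thesis using TV(2)[of "A v" v] unfolding mem by metis
      next
        case 3
        then show ?thesis using TV(2)[of "B v" v] unfolding mem by metis
      qed
    qed
  }
qed

lemma mem_aztec_vertices:
  "(x, y) \<in> aztec_vertices k (p, q) \<longleftrightarrow> \<bar>2 * (x - p) + 1\<bar> + \<bar>2 * (y - q) + 1\<bar> \<le> 2 * int k"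
proof
  assume "(x, y) \<in> aztec_vertices k (p, q)"
  then show "\<bar>2 * (x - p) + 1\<bar> + \<bar>2 * (y - q) + 1\<bar> \<le> 2 * int k"
    by (auto simp: aztec_vertices_def face_vertices_def internal_faces_def)
next
  assume a: "\<bar>2 * (x - p) + 1\<bar> + \<bar>2 * (y - q) + 1\<bar> \<le> 2 * int k"
  \<comment> \<open>Of the four faces at the vertex, the one nearest to the centre.\<close>
  let ?C = "(if x \<ge> p then x else x + 1, if y \<ge> q then y else y + 1)"
  have "?C \<in> internal_faces k (p, q)" "(x, y) \<in> face_vertices ?C"
    using a by (auto simp: internal_faces_def face_vertices_def)
  then show "(x, y) \<in> aztec_vertices k (p, q)" unfolding aztec_vertices_def by blast
qed

lemma finite_internal_faces: "finite (internal_faces k c)"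
proof (cases c)
  case (Pair p q)
  show ?thesis
    by (rule finite_subset[of _ "{p - int k..p + int k} \<times> {q - int k..q + int k}"])
      (auto simp: Pair internal_faces_def)
qed

lemma finite_aztec_vertices: "finite (aztec_vertices k c)"
  by (simp add: aztec_vertices_def finite_internal_faces finite_face_vertices)

lemma adjacent_cases:
  assumes "adjacent u v"
  obtains x y where "u = (x, y)" "v = (x + 1, y)" | x y where "u = (x + 1, y)" "v = (x, y)"
  | x y where "u = (x, y)" "v = (x, y + 1)" | x y where "u = (x, y + 1)" "v = (x, y)"
proof -
  obtain x y x' y' where uv: "u = (x, y)" "v = (x', y')" by fastforce
  then have "\<bar>x - x'\<bar> + \<bar>y - y'\<bar> = 1" using assms by (simp add: adjacent_def)
  then consider "x' = x + 1 \<and> y' = y" | "x = x' + 1 \<and> y' = y" | "x' = x \<and> y' = y + 1" | "x = x' \<and> y = y' + 1"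
    by linarith
  then show ?thesis using that uv by cases auto
qed

text \<open>The diamond is an induced subgraph: of the two faces along an edge between two of its
  vertices, the one nearer to the centre is internal.\<close>

lemma aztec_dedges_eq: "aztec_dedges k c = edges_in (aztec_vertices k c)"
proof (intro set_eqI iffI)
  fix e assume "e \<in> aztec_dedges k c"
  then show "e \<in> edges_in (aztec_vertices k c)"
    by (fastforce simp: aztec_dedges_def face_dedges_def edges_in_def aztec_vertices_def)
next
  fix e assume e: "e \<in> edges_in (aztec_vertices k c)"
  obtain u v where uv: "e = (u, v)" by (cases e)
  obtain p q where c: "c = (p, q)" by fastforce
  have V: "u \<in> aztec_vertices k c" "v \<in> aztec_vertices k c" and adj: "adjacent u v"
    using e uv by (auto simp: edges_in_def)
  have "\<exists>C \<in> internal_faces k c. u \<in> face_vertices C \<and> v \<in> face_vertices C"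
    using adj
  proof (cases rule: adjacent_cases)
    case (1 x y)
    then show ?thesis using V c
      by (intro bexI[of _ "(x + 1, if y \<ge> q then y else y + 1)"])
        (auto simp: internal_faces_def face_vertices_def mem_aztec_vertices)
  next
    case (2 x y)
    then show ?thesis using V c
      by (intro bexI[of _ "(x + 1, if y \<ge> q then y else y + 1)"])
        (auto simp: internal_faces_def face_vertices_def mem_aztec_vertices)
  next
    case (3 x y)
    then show ?thesis using V c
      by (intro bexI[of _ "(if x \<ge> p then x else x + 1, y + 1)"])
        (auto simp: internal_faces_def face_vertices_def mem_aztec_vertices)
  next
    case (4 x y)
    then show ?thesis using V c
      by (intro bexI[of _ "(if x \<ge> p then x else x + 1, y + 1)"])
        (auto simp: internal_faces_def face_vertices_def mem_aztec_vertices)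
  qed
  then show "e \<in> aztec_dedges k c" using adj uv by (auto simp: aztec_dedges_def face_dedges_def)
qed

lemma oriented_dimers_eq: "oriented_dimers k c = dimer_covers (aztec_vertices k c)"
proof (intro set_eqI iffI)
  fix M assume M: "M \<in> oriented_dimers k c"
  then have inj: "inj_on undirected M" and ME: "M \<subseteq> edges_in (aztec_vertices k c)"
    and ex: "\<And>v. v \<in> aztec_vertices k c \<Longrightarrow> \<exists>!d. d \<in> undirected ` M \<and> v \<in> d"
    by (auto simp: oriented_dimers_def perfect_matching_def aztec_dedges_eq)
  show "M \<in> dimer_covers (aztec_vertices k c)"
  proof (rule dimer_coversI[OF ME])
    show "\<exists>e\<in>M. v \<in> undirected e" if "v \<in> aztec_vertices k c" for v
      using ex[OF that] by blast
    fix e e' v assume e: "e \<in> M" "e' \<in> M" "v \<in> undirected e" "v \<in> undirected e'"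
    then have "v \<in> aztec_vertices k c" using ME edges_in_undirected by blast
    then have "undirected e = undirected e'" using ex e by blast
    then show "e = e'" using inj e by (simp add: inj_on_def)
  qed
next
  fix M assume M: "M \<in> dimer_covers (aztec_vertices k c)"
  have "inj_on undirected M"
  proof (rule inj_onI)
    fix e e' assume e: "e \<in> M" "e' \<in> M" "undirected e = undirected e'"
    obtain v where "v \<in> undirected e" using undirected_nonempty by blast
    then show "e = e'" using dimer_covers_unique[OF M e(1,2)] e(3) by simp
  qed
  moreover have "\<exists>!d. d \<in> undirected ` M \<and> v \<in> d" if v: "v \<in> aztec_vertices k c" for v
  proof -
    obtain e where e: "e \<in> M" "v \<in> undirected e" using dimer_coversD(2)[OF M v] by blast
    show ?thesis
    proof (rule ex1I[of _ "undirected e"])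
      fix d assume "d \<in> undirected ` M \<and> v \<in> d"
      then obtain e' where "e' \<in> M" "v \<in> undirected e'" "d = undirected e'" by blast
      then show "d = undirected e" using dimer_covers_unique[OF M e(1) _ e(2)] by blast
    qed (use e in blast)
  qed
  ultimately show "M \<in> oriented_dimers k c"
    using dimer_coversD(1)[OF M]
    by (auto simp: oriented_dimers_def perfect_matching_def aztec_dedges_eq)
qed

lemma dimer_Z_eq: "dimer_Z k c a \<phi> = cover_sum (aztec_vertices k c) (\<lambda>e. \<phi> e * a (right_face e))"
  unfolding dimer_Z_def cover_sum_def oriented_dimers_eq ..

text \<open>The cells are the internal faces of the parity of those nearest to the boundary; they cut the
  edge set of the Aztec diamond into squares.\<close>

definition aztec_cells :: "nat \<Rightarrow> face \<Rightarrow> face set" where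
  "aztec_cells k = (\<lambda>(p, q). {(x, y). \<bar>x - p\<bar> + \<bar>y - q\<bar> < int k \<and> odd (x + y + p + q + int k)})"

lemma aztec_cells_subset: "aztec_cells k c \<subseteq> internal_faces k c"
  by (auto simp: aztec_cells_def internal_faces_def)

lemma finite_aztec_cells: "finite (aztec_cells k c)"
  by (rule finite_subset[OF aztec_cells_subset finite_internal_faces])

lemma mem_aztec_cells:
  "(x, y) \<in> aztec_cells k (p, q) \<longleftrightarrow> \<bar>x - p\<bar> + \<bar>y - q\<bar> < int k \<and> odd (x + y + (p + q + int k))"
  by (simp add: aztec_cells_def add.assoc)

lemma mem_face_vertices:
  "(x, y) \<in> face_vertices (a, b) \<longleftrightarrow> (a = x \<or> a = x + 1) \<and> (b = y \<or> b = y + 1)"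
  by (auto simp: face_vertices_def)

text \<open>With \<open>s = p + q + int k\<close>, the parity of the cells is
  \<open>odd (x + y + s)\<close>. Two of the four faces at a vertex have it, diagonally opposite to
  each other, and the parity of the vertex decides on which diagonal; \<open>cell_a\<close> is the
  lower and \<open>cell_b\<close> the upper one.\<close>

definition cell_a :: "int \<Rightarrow> vertex \<Rightarrow> face" where
  "cell_a s = (\<lambda>(x, y). if odd (x + y + s) then (x, y) else (x + 1, y))"

definition cell_b :: "int \<Rightarrow> vertex \<Rightarrow> face" where
  "cell_b s = (\<lambda>(x, y). if odd (x + y + s) then (x + 1, y + 1) else (x, y + 1))"

lemma mem_face_vertices_cell:
  assumes "C \<in> aztec_cells k (p, q)"
  shows "v \<in> face_vertices C \<longleftrightarrow> C = cell_a (p + q + int k) v \<or> C = cell_b (p + q + int k) v"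
proof -
  obtain a b x y where ab: "C = (a, b)" "v = (x, y)" by fastforce
  have "odd (a + b + (p + q + int k))" using assms by (simp add: ab mem_aztec_cells)
  then show ?thesis
    by (auto simp: ab mem_face_vertices cell_a_def cell_b_def)
qed

lemma cell_a_neq_cell_b: "cell_a s v \<noteq> cell_b s v"
  by (cases v) (auto simp: cell_a_def cell_b_def)

lemma abs_succ_int:
  fixes X :: int
  obtains "0 \<le> X" "\<bar>X\<bar> = X" "\<bar>X + 1\<bar> = X + 1" "\<bar>2 * X + 1\<bar> = 2 * X + 1"
  | "X < 0" "\<bar>X\<bar> = - X" "\<bar>X + 1\<bar> = - X - 1" "\<bar>2 * X + 1\<bar> = - 2 * X - 1"
  by (cases "0 \<le> X") auto

text \<open>\<open>(X, Y)\<close> and \<open>(X + 1, Y + 1)\<close> are the two candidate cells at a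
  vertex, relative to the centre. Their distances both equal that of the vertex, or one is smaller
  and one larger by 1; parity rules out the value \<open>K\<close>, where \<open><\<close> and
  \<open>\<le>\<close> would disagree. One cell suffices for the diamond of size \<open>K\<close>,
  two are needed for size \<open>K - 1\<close>.\<close>

lemma cell_dist:
  fixes X Y K :: int
  assumes "odd (X + Y + K)"
  shows "\<bar>X\<bar> + \<bar>Y\<bar> < K \<or> \<bar>X + 1\<bar> + \<bar>Y + 1\<bar> < K \<longleftrightarrow> \<bar>2 * X + 1\<bar> + \<bar>2 * Y + 1\<bar> \<le> 2 * K"
    "\<bar>X\<bar> + \<bar>Y\<bar> < K \<and> \<bar>X + 1\<bar> + \<bar>Y + 1\<bar> < K \<longleftrightarrow> \<bar>2 * X + 1\<bar> + \<bar>2 * Y + 1\<bar> \<le> 2 * (K - 1)"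
  by (cases X rule: abs_succ_int; cases Y rule: abs_succ_int; use assms in simp; presburger)+

lemma cell_dist':
  fixes X Y K :: int
  assumes "even (X + Y + K)"
  shows "\<bar>X + 1\<bar> + \<bar>Y\<bar> < K \<or> \<bar>X\<bar> + \<bar>Y + 1\<bar> < K \<longleftrightarrow> \<bar>2 * X + 1\<bar> + \<bar>2 * Y + 1\<bar> \<le> 2 * K"
    "\<bar>X + 1\<bar> + \<bar>Y\<bar> < K \<and> \<bar>X\<bar> + \<bar>Y + 1\<bar> < K \<longleftrightarrow> \<bar>2 * X + 1\<bar> + \<bar>2 * Y + 1\<bar> \<le> 2 * (K - 1)"
  by (cases X rule: abs_succ_int; cases Y rule: abs_succ_int; use assms in simp; presburger)+

text \<open>For the horizontal edge from \<open>(X, Y)\<close> to \<open>(X + 1, Y)\<close>: of the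
  face \<open>(X + 1, Y + 1)\<close> above and the face \<open>(X + 1, Y)\<close> below, the one
  with the parity of the cells is internal.\<close>

lemma edge_cell_dist:
  fixes X Y K :: int
  assumes "\<bar>2 * X + 1\<bar> + \<bar>2 * Y + 1\<bar> \<le> 2 * K" "\<bar>2 * (X + 1) + 1\<bar> + \<bar>2 * Y + 1\<bar> \<le> 2 * K"
  shows "odd (X + Y + K) \<Longrightarrow> \<bar>X + 1\<bar> + \<bar>Y + 1\<bar> < K" "even (X + Y + K) \<Longrightarrow> \<bar>X + 1\<bar> + \<bar>Y\<bar> < K"
proof -
  have *: "2 * X + 3 + \<bar>2 * Y + 1\<bar> \<le> 2 * K" "- 2 * X - 1 + \<bar>2 * Y + 1\<bar> \<le> 2 * K"
    using assms abs_ge_self[of "2 * (X + 1) + 1"] abs_ge_minus_self[of "2 * X + 1"] by simp_all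
  show "odd (X + Y + K) \<Longrightarrow> \<bar>X + 1\<bar> + \<bar>Y + 1\<bar> < K" "even (X + Y + K) \<Longrightarrow> \<bar>X + 1\<bar> + \<bar>Y\<bar> < K"
    by (cases X rule: abs_succ_int; cases Y rule: abs_succ_int; use * in \<open>simp del: even_add\<close>; presburger)+
qed

lemma cells_odd:
  assumes "odd (x + y + (p + q + int k))"
  shows "cell_a (p + q + int k) (x, y) \<in> aztec_cells k (p, q) \<longleftrightarrow> \<bar>x - p\<bar> + \<bar>y - q\<bar> < int k"
    "cell_b (p + q + int k) (x, y) \<in> aztec_cells k (p, q) \<longleftrightarrow> \<bar>x - p + 1\<bar> + \<bar>y - q + 1\<bar> < int k"
proof -
  have o: "odd (x + 1 + (y + 1) + (p + q + int k))" using assms by presburger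
  show "cell_a (p + q + int k) (x, y) \<in> aztec_cells k (p, q) \<longleftrightarrow> \<bar>x - p\<bar> + \<bar>y - q\<bar> < int k"
    unfolding cell_a_def prod.case if_P[OF assms] mem_aztec_cells using assms by blast
  show "cell_b (p + q + int k) (x, y) \<in> aztec_cells k (p, q) \<longleftrightarrow> \<bar>x - p + 1\<bar> + \<bar>y - q + 1\<bar> < int k"
    unfolding cell_b_def prod.case if_P[OF assms] mem_aztec_cells diff_add_eq using o by blast
qed

lemma cells_even:
  assumes "\<not> odd (x + y + (p + q + int k))"
  shows "cell_a (p + q + int k) (x, y) \<in> aztec_cells k (p, q) \<longleftrightarrow> \<bar>x - p + 1\<bar> + \<bar>y - q\<bar> < int k"
    "cell_b (p + q + int k) (x, y) \<in> aztec_cells k (p, q) \<longleftrightarrow> \<bar>x - p\<bar> + \<bar>y - q + 1\<bar> < int k"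
proof -
  have o: "odd (x + 1 + y + (p + q + int k))" "odd (x + (y + 1) + (p + q + int k))" using assms by presburger+
  show "cell_a (p + q + int k) (x, y) \<in> aztec_cells k (p, q) \<longleftrightarrow> \<bar>x - p + 1\<bar> + \<bar>y - q\<bar> < int k"
    unfolding cell_a_def prod.case if_not_P[OF assms] mem_aztec_cells diff_add_eq using o by blast
  show "cell_b (p + q + int k) (x, y) \<in> aztec_cells k (p, q) \<longleftrightarrow> \<bar>x - p\<bar> + \<bar>y - q + 1\<bar> < int k"
    unfolding cell_b_def prod.case if_not_P[OF assms] mem_aztec_cells diff_add_eq using o by blast
qed

lemma aztec_vertices_cells:
  "v \<in> aztec_vertices k (p, q) \<longleftrightarrow>
     cell_a (p + q + int k) v \<in> aztec_cells k (p, q) \<or> cell_b (p + q + int k) v \<in> aztec_cells k (p, q)"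
  "v \<in> aztec_vertices k (p, q) \<longleftrightarrow>
     cell_a (p + q + int (Suc k)) v \<in> aztec_cells (Suc k) (p, q) \<and>
     cell_b (p + q + int (Suc k)) v \<in> aztec_cells (Suc k) (p, q)"
proof -
  obtain x y where v: "v = (x, y)" by fastforce
  have par: "even (x + y + (p + q + K)) \<longleftrightarrow> even (x - p + (y - q) + K)" for K :: int by presburger
  show "v \<in> aztec_vertices k (p, q) \<longleftrightarrow>
     cell_a (p + q + int k) v \<in> aztec_cells k (p, q) \<or> cell_b (p + q + int k) v \<in> aztec_cells k (p, q)"
  proof (cases "odd (x + y + (p + q + int k))")
    case True
    then have *: "odd (x - p + (y - q) + int k)" using par[of "int k"] by blast
    show ?thesis unfolding v cells_odd[OF True] cell_dist(1)[OF *] mem_aztec_vertices ..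
  next
    case False
    then have *: "\<not> odd (x + y + (p + q + int k))" "even (x - p + (y - q) + int k)" using par[of "int k"] by blast+
    show ?thesis unfolding v cells_even[OF *(1)] cell_dist'(1)[OF *(2)] mem_aztec_vertices ..
  qed
  have K: "int k = int (Suc k) - 1" by simp
  show "v \<in> aztec_vertices k (p, q) \<longleftrightarrow>
     cell_a (p + q + int (Suc k)) v \<in> aztec_cells (Suc k) (p, q) \<and>
     cell_b (p + q + int (Suc k)) v \<in> aztec_cells (Suc k) (p, q)"
  proof (cases "odd (x + y + (p + q + int (Suc k)))")
    case True
    then have *: "odd (x - p + (y - q) + int (Suc k))" using par[of "int (Suc k)"] by blast
    show ?thesis unfolding v cells_odd[OF True] cell_dist(2)[OF *] mem_aztec_vertices by simp
  next
    case False
    then have *: "\<not> odd (x + y + (p + q + int (Suc k)))" "even (x - p + (y - q) + int (Suc k))"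
      using par[of "int (Suc k)"] by blast+
    show ?thesis unfolding v cells_even[OF *(1)] cell_dist'(2)[OF *(2)] mem_aztec_vertices by simp
  qed
qed

lemma aztec_vertices_mono: "aztec_vertices k c \<subseteq> aztec_vertices (Suc k) c"
  by (cases c) (auto simp: mem_aztec_vertices)

text \<open>The two faces along an edge have opposite parities, so only one can be a cell, and
  \<open>edge_cell_dist\<close> puts it inside the diamond.\<close>

lemma ex1_aztec_cell:
  assumes e: "e \<in> edges_in (aztec_vertices k c)"
  shows "\<exists>!C. C \<in> aztec_cells k c \<and> undirected e \<subseteq> face_vertices C"
proof -
  obtain p q where c: "c = (p, q)" by fastforce
  let ?s = "p + q + int k"
  have hor: "\<exists>!C. C \<in> aztec_cells k c \<and> {(x, y), (x + 1, y)} \<subseteq> face_vertices C"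
    if "(x, y) \<in> aztec_vertices k c" "(x + 1, y) \<in> aztec_vertices k c" for x y
  proof -
    have V: "\<bar>2 * (x - p) + 1\<bar> + \<bar>2 * (y - q) + 1\<bar> \<le> 2 * int k"
      "\<bar>2 * (x - p + 1) + 1\<bar> + \<bar>2 * (y - q) + 1\<bar> \<le> 2 * int k"
      using that by (simp_all add: c mem_aztec_vertices algebra_simps)
    show ?thesis
    proof (cases "odd (x + y + ?s)")
      case True
      have o: "odd (x + 1 + (y + 1) + ?s)" "odd (x - p + (y - q) + int k)" using True by presburger+
      show ?thesis
      proof (rule ex1I[of _ "(x + 1, y + 1)"])
        show "(x + 1, y + 1) \<in> aztec_cells k c \<and> {(x, y), (x + 1, y)} \<subseteq> face_vertices (x + 1, y + 1)"
          using edge_cell_dist(1)[OF V o(2)] o(1) unfolding c mem_aztec_cells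
          by (simp add: mem_face_vertices algebra_simps del: even_add)
        fix C assume C: "C \<in> aztec_cells k c \<and> {(x, y), (x + 1, y)} \<subseteq> face_vertices C"
        obtain a b where ab: "C = (a, b)" by fastforce
        have f: "a = x + 1" "b = y \<or> b = y + 1"
          using C by (auto simp: ab mem_face_vertices)
        have "odd (a + b + ?s)" using C unfolding ab c mem_aztec_cells by blast
        then have "a = x + 1" "b = y + 1" using f True by presburger+
        then show "C = (x + 1, y + 1)" using ab by blast
      qed
    next
      case False
      have o: "odd (x + 1 + (y) + ?s)" "even (x - p + (y - q) + int k)" using False by presburger+
      show ?thesis
      proof (rule ex1I[of _ "(x + 1, y)"])
        show "(x + 1, y) \<in> aztec_cells k c \<and> {(x, y), (x + 1, y)} \<subseteq> face_vertices (x + 1, y)"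
          using edge_cell_dist(2)[OF V o(2)] o(1) unfolding c mem_aztec_cells
          by (simp add: mem_face_vertices algebra_simps del: even_add)
        fix C assume C: "C \<in> aztec_cells k c \<and> {(x, y), (x + 1, y)} \<subseteq> face_vertices C"
        obtain a b where ab: "C = (a, b)" by fastforce
        have f: "a = x + 1" "b = y \<or> b = y + 1"
          using C by (auto simp: ab mem_face_vertices)
        have "odd (a + b + ?s)" using C unfolding ab c mem_aztec_cells by blast
        then have "a = x + 1" "b = y" using f False by presburger+
        then show "C = (x + 1, y)" using ab by blast
      qed
    qed
  qed
  have ver: "\<exists>!C. C \<in> aztec_cells k c \<and> {(x, y), (x, y + 1)} \<subseteq> face_vertices C"
    if "(x, y) \<in> aztec_vertices k c" "(x, y + 1) \<in> aztec_vertices k c" for x y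
  proof -
    \<comment> \<open>The coordinates are exchanged, so that \<open>edge_cell_dist\<close> serves
      the vertical edges too.\<close>
    have V: "\<bar>2 * (y - q) + 1\<bar> + \<bar>2 * (x - p) + 1\<bar> \<le> 2 * int k"
      "\<bar>2 * (y - q + 1) + 1\<bar> + \<bar>2 * (x - p) + 1\<bar> \<le> 2 * int k"
      using that by (simp_all add: c mem_aztec_vertices algebra_simps)
    show ?thesis
    proof (cases "odd (x + y + ?s)")
      case True
      have o: "odd (x + 1 + (y + 1) + ?s)" "odd (y - q + (x - p) + int k)" using True by presburger+
      show ?thesis
      proof (rule ex1I[of _ "(x + 1, y + 1)"])
        show "(x + 1, y + 1) \<in> aztec_cells k c \<and> {(x, y), (x, y + 1)} \<subseteq> face_vertices (x + 1, y + 1)"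
          using edge_cell_dist(1)[OF V o(2)] o(1) unfolding c mem_aztec_cells
          by (simp add: mem_face_vertices algebra_simps del: even_add)
        fix C assume C: "C \<in> aztec_cells k c \<and> {(x, y), (x, y + 1)} \<subseteq> face_vertices C"
        obtain a b where ab: "C = (a, b)" by fastforce
        have f: "a = x \<or> a = x + 1" "b = y + 1"
          using C by (auto simp: ab mem_face_vertices)
        have "odd (a + b + ?s)" using C unfolding ab c mem_aztec_cells by blast
        then have "a = x + 1" "b = y + 1" using f True by presburger+
        then show "C = (x + 1, y + 1)" using ab by blast
      qed
    next
      case False
      have o: "odd (x + (y + 1) + ?s)" "even (y - q + (x - p) + int k)" using False by presburger+
      show ?thesis
      proof (rule ex1I[of _ "(x, y + 1)"])
        show "(x, y + 1) \<in> aztec_cells k c \<and> {(x, y), (x, y + 1)} \<subseteq> face_vertices (x, y + 1)"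
          using edge_cell_dist(2)[OF V o(2)] o(1) unfolding c mem_aztec_cells
          by (simp add: mem_face_vertices algebra_simps del: even_add)
        fix C assume C: "C \<in> aztec_cells k c \<and> {(x, y), (x, y + 1)} \<subseteq> face_vertices C"
        obtain a b where ab: "C = (a, b)" by fastforce
        have f: "a = x \<or> a = x + 1" "b = y + 1"
          using C by (auto simp: ab mem_face_vertices)
        have "odd (a + b + ?s)" using C unfolding ab c mem_aztec_cells by blast
        then have "a = x" "b = y + 1" using f False by presburger+
        then show "C = (x, y + 1)" using ab by blast
      qed
    qed
  qed
  obtain u v where uv: "e = (u, v)" by (cases e)
  have V: "u \<in> aztec_vertices k c" "v \<in> aztec_vertices k c" and adj: "adjacent u v"
    using e uv by (auto simp: edges_in_def)
  from adj show ?thesis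
  proof (cases rule: adjacent_cases)
    case (1 x y)
    then show ?thesis using hor[of x y] V by (simp add: uv undirected_eq)
  next
    case (2 x y)
    then show ?thesis using hor[of x y] V by (simp add: uv undirected_eq conj_commute)
  next
    case (3 x y)
    then show ?thesis using ver[of x y] V by (simp add: uv undirected_eq)
  next
    case (4 x y)
    then show ?thesis using ver[of x y] V by (simp add: uv undirected_eq conj_commute)
  qed
qed

text \<open>Urban renewal without graph surgery. In every cell, the set of corners that are matched inside the
  cell is replaced by its complement. A vertex of the smaller diamond lies in two cells and is matched
  in exactly one of them, before and after; the other vertices lie in one cell only and disappear.\<close>

lemma cover_sum_aztec_Suc:
  assumes D: "\<And>C. C \<in> aztec_cells (Suc k) c \<Longrightarrow> cell_sum w C \<noteq> 0"
    and w': "\<And>x y. (x, y) \<in> aztec_cells (Suc k) c \<Longrightarrow>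
        edge_sum w' (x, y) (x - 1, y) = edge_sum w (x - 1, y - 1) (x, y - 1) / cell_sum w (x, y) \<and>
        edge_sum w' (x - 1, y - 1) (x, y - 1) = edge_sum w (x, y) (x - 1, y) / cell_sum w (x, y) \<and>
        edge_sum w' (x, y) (x, y - 1) = edge_sum w (x - 1, y - 1) (x - 1, y) / cell_sum w (x, y) \<and>
        edge_sum w' (x - 1, y - 1) (x - 1, y) = edge_sum w (x, y) (x, y - 1) / cell_sum w (x, y)"
  shows "cover_sum (aztec_vertices (Suc k) c) w
    = (\<Prod>C\<in>aztec_cells (Suc k) c. cell_sum w C) * cover_sum (aztec_vertices k c) w'"
proof -
  obtain p q where c: "c = (p, q)" by fastforce
  let ?I = "aztec_cells (Suc k) c" and ?s = "p + q + int (Suc k)"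
  let ?compl = "\<lambda>T. \<lambda>C\<in>?I. face_vertices C - T C"
  note compl = cell_splits_complement[of ?I "cell_a ?s" "cell_b ?s" "aztec_vertices (Suc k) c" "aztec_vertices k c",
      OF mem_face_vertices_cell[of _ "Suc k" p q, folded c] cell_a_neq_cell_b
        aztec_vertices_cells(1)[of _ "Suc k" p q, folded c] aztec_vertices_cells(2)[of _ k p q, folded c]]
  have dual: "cover_sum T w = cell_sum w C * cover_sum (face_vertices C - T) w'"
    if "C \<in> ?I" "T \<subseteq> face_vertices C" for C T
    using cover_sum_square_dual[of T "fst C" "snd C" w w'] that D[of C] w'[of "fst C" "snd C"] by simp
  have cc: "?compl (?compl T) = T" if "T \<in> cell_splits ?I S" for T S
  proof
    fix C show "?compl (?compl T) C = T C"
      using that PiE_arb[of T ?I "\<lambda>C. Pow (face_vertices C)" C]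
      by (cases "C \<in> ?I") (auto simp: cell_splits_def)
  qed
  have "cover_sum (aztec_vertices (Suc k) c) w
      = (\<Sum>T\<in>cell_splits ?I (aztec_vertices (Suc k) c). \<Prod>C\<in>?I. cover_sum (T C) w)"
    by (intro cover_sum_cells finite_aztec_vertices finite_aztec_cells ex1_aztec_cell)
  also have "\<dots> = (\<Sum>T\<in>cell_splits ?I (aztec_vertices k c). \<Prod>C\<in>?I. cell_sum w C * cover_sum (T C) w')"
  proof (rule sum.reindex_bij_witness[where i = ?compl and j = ?compl])
    fix T assume T: "T \<in> cell_splits ?I (aztec_vertices (Suc k) c)"
    show "?compl (?compl T) = T" using cc[OF T] .
    show "?compl T \<in> cell_splits ?I (aztec_vertices k c)" using compl(1)[OF _ T] by simp
    show "(\<Prod>C\<in>?I. cell_sum w C * cover_sum (?compl T C) w') = (\<Prod>C\<in>?I. cover_sum (T C) w)"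
    proof (rule prod.cong[OF refl])
      fix C assume C: "C \<in> ?I"
      have "T \<in> (\<Pi>\<^sub>E C\<in>?I. Pow (face_vertices C))" using T by (simp add: cell_splits_def)
      then have "T C \<subseteq> face_vertices C" using C by auto
      then show "cell_sum w C * cover_sum (?compl T C) w' = cover_sum (T C) w"
        using dual[OF C, of "T C"] C by simp
    qed
  next
    fix T assume T: "T \<in> cell_splits ?I (aztec_vertices k c)"
    show "?compl (?compl T) = T" using cc[OF T] .
    show "?compl T \<in> cell_splits ?I (aztec_vertices (Suc k) c)" using compl(2)[OF _ T] by simp
  qed
  also have "\<dots> = (\<Prod>C\<in>?I. cell_sum w C) * (\<Sum>T\<in>cell_splits ?I (aztec_vertices k c). \<Prod>C\<in>?I. cover_sum (T C) w')"
    by (simp add: prod.distrib sum_distrib_left)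
  \<comment> \<open>The smaller diamond is cut up by the cells of the larger one, whose parity is
    opposite to that of its own cells.\<close>
  also have "(\<Sum>T\<in>cell_splits ?I (aztec_vertices k c). \<Prod>C\<in>?I. cover_sum (T C) w')
      = cover_sum (aztec_vertices k c) w'"
    using edges_in_mono[OF aztec_vertices_mono]
    by (intro cover_sum_cells[symmetric] finite_aztec_vertices finite_aztec_cells ex1_aztec_cell) blast
  finally show ?thesis .
qed

section \<open>The dSKP equation\<close>

definition dskp_delta :: "real \<Rightarrow> real \<Rightarrow> real \<Rightarrow> real \<Rightarrow> real \<Rightarrow> real" where
  "dskp_delta c n e s w = (n - c) * (s - c) - (c - e) * (c - w)"

text \<open>The dSKP equation (multi-ratio \<open>-1\<close>), solved for the new label \<open>c'\<close> of a face from its old label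
  \<open>c\<close> and the labels of its northern, eastern, southern and western neighbours.\<close>

definition dskp :: "real \<Rightarrow> real \<Rightarrow> real \<Rightarrow> real \<Rightarrow> real \<Rightarrow> real \<Rightarrow> bool" where
  "dskp c n e s w c' \<longleftrightarrow> dskp_delta c n e s w \<noteq> 0 \<and>
     c' * dskp_delta c n e s w = (e - c) * (s - w) * n + (c - s) * (e - n) * w \<and>
     n \<noteq> e \<and> n \<noteq> w \<and> s \<noteq> e \<and> s \<noteq> w"

text \<open>Solving for \<open>c'\<close> hides the symmetry of the equation. Here each difference
  between \<open>c'\<close> and a neighbour factors into an old difference at the opposite edge and
  two differences of neighbours, which is the shape of a gauged dual weight.\<close>

lemma dskp_diff:
  assumes "dskp c n e s w c'"
  shows "(c' - n) * dskp_delta c n e s w = (c - s) * (e - n) * (w - n)"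
    "(c' - s) * dskp_delta c n e s w = (c - n) * (e - s) * (w - s)"
    "(c' - e) * dskp_delta c n e s w = (w - c) * (n - e) * (s - e)"
    "(c' - w) * dskp_delta c n e s w = (e - c) * (n - w) * (s - w)"
proof -
  have *: "c' * dskp_delta c n e s w = (e - c) * (s - w) * n + (c - s) * (e - n) * w"
    using assms by (simp add: dskp_def)
  show "(c' - n) * dskp_delta c n e s w = (c - s) * (e - n) * (w - n)"
    "(c' - s) * dskp_delta c n e s w = (c - n) * (e - s) * (w - s)"
    "(c' - e) * dskp_delta c n e s w = (w - c) * (n - e) * (s - e)"
    "(c' - w) * dskp_delta c n e s w = (e - c) * (n - w) * (s - w)"
    unfolding left_diff_distrib * unfolding dskp_delta_def by algebra+
qed

text \<open>The denominator of the inverted equation is the old numerator divided by the product of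
  the five old labels, hence the factor \<open>c' / (c * n * e * s * w)\<close>.\<close>

lemma dskp_inverse:
  assumes d: "dskp c n e s w c'" and nz: "c \<noteq> 0" "n \<noteq> 0" "e \<noteq> 0" "s \<noteq> 0" "w \<noteq> 0" "c' \<noteq> 0"
  shows "dskp_delta (inverse c) (inverse n) (inverse e) (inverse s) (inverse w)
      = c' / (c * n * e * s * w) * dskp_delta c n e s w"
    and "dskp (inverse c) (inverse n) (inverse e) (inverse s) (inverse w) (inverse c')"
proof -
  let ?d = "dskp_delta c n e s w"
  have *: "c' * ?d = (e - c) * (s - w) * n + (c - s) * (e - n) * w"
    using d by (simp add: dskp_def)
  have "dskp_delta (inverse c) (inverse n) (inverse e) (inverse s) (inverse w)
      = ((e - c) * (s - w) * n + (c - s) * (e - n) * w) / (c * n * e * s * w)"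
    using nz unfolding dskp_delta_def by (simp add: field_simps)
  then show eq: "dskp_delta (inverse c) (inverse n) (inverse e) (inverse s) (inverse w)
      = c' / (c * n * e * s * w) * ?d"
    by (simp add: * [symmetric])
  have s: "(inverse e - inverse c) * (inverse s - inverse w) * inverse n
      + (inverse c - inverse s) * (inverse e - inverse n) * inverse w = ?d / (c * n * e * s * w)"
    using nz unfolding dskp_delta_def by (simp add: field_simps)
  have d': "?d \<noteq> 0" "n \<noteq> e" "n \<noteq> w" "s \<noteq> e" "s \<noteq> w" using d by (auto simp: dskp_def)
  show "dskp (inverse c) (inverse n) (inverse e) (inverse s) (inverse w) (inverse c')"
    unfolding dskp_def eq s using d' nz by simp
qed

definition right_weight :: "(dedge \<Rightarrow> real) \<Rightarrow> (face \<Rightarrow> real) \<Rightarrow> dedge \<Rightarrow> real" where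
  "right_weight \<phi> a e = \<phi> e * a (right_face e)"

text \<open>Each square is traversed from its upper right and lower left corners. These are the white
  corners for one parity of the square and the black ones for the other, but the product of the four
  signs is the same.\<close>

definition square_orientation :: "nat \<Rightarrow> face \<Rightarrow> (dedge \<Rightarrow> real) \<Rightarrow> bool" where
  "square_orientation k c \<phi> \<longleftrightarrow>
     (\<forall>(u, v) \<in> edges_in (aztec_vertices k c). \<phi> (u, v) \<in> {-1, 1} \<and> \<phi> (v, u) = - \<phi> (u, v)) \<and>
     (\<forall>(x, y) \<in> internal_faces k c. \<phi> ((x, y), (x - 1, y)) * \<phi> ((x - 1, y - 1), (x, y - 1))
        * (\<phi> ((x, y), (x, y - 1)) * \<phi> ((x - 1, y - 1), (x - 1, y))) = -1)"

definition flip_horizontal :: "(dedge \<Rightarrow> real) \<Rightarrow> dedge \<Rightarrow> real" where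
  "flip_horizontal \<phi> = (\<lambda>(u, v). if snd u = snd v then - \<phi> (u, v) else \<phi> (u, v))"

lemma internal_faces_mono: "internal_faces k c \<subseteq> internal_faces (Suc k) c"
  by (auto simp: internal_faces_def)

text \<open>Each square has two horizontal edges, so flipping them keeps the product of its four
  signs.\<close>

lemma square_orientation_flip:
  assumes "square_orientation (Suc k) c \<phi>"
  shows "square_orientation k c (flip_horizontal \<phi>)"
  using assms edges_in_mono[OF aztec_vertices_mono[of k c]] internal_faces_mono[of k c]
  unfolding square_orientation_def flip_horizontal_def by fastforce

lemma face_edges_in:
  assumes "(x, y) \<in> internal_faces k c"
  shows "((x, y), (x - 1, y)) \<in> edges_in (aztec_vertices k c)"
    "((x - 1, y - 1), (x, y - 1)) \<in> edges_in (aztec_vertices k c)"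
    "((x, y), (x, y - 1)) \<in> edges_in (aztec_vertices k c)"
    "((x - 1, y - 1), (x - 1, y)) \<in> edges_in (aztec_vertices k c)"
proof -
  have "face_vertices (x, y) \<subseteq> aztec_vertices k c"
    using assms by (auto simp: aztec_vertices_def)
  then have "(x, y) \<in> aztec_vertices k c" "(x - 1, y) \<in> aztec_vertices k c"
    "(x, y - 1) \<in> aztec_vertices k c" "(x - 1, y - 1) \<in> aztec_vertices k c"
    by (auto simp: face_vertices_def)
  then show "((x, y), (x - 1, y)) \<in> edges_in (aztec_vertices k c)"
    "((x - 1, y - 1), (x, y - 1)) \<in> edges_in (aztec_vertices k c)"
    "((x, y), (x, y - 1)) \<in> edges_in (aztec_vertices k c)"
    "((x - 1, y - 1), (x - 1, y)) \<in> edges_in (aztec_vertices k c)"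
    by (auto simp: edges_in_def adjacent_def)
qed

lemma right_face_square:
  fixes x y :: int
  shows "right_face ((x, y), (x - 1, y)) = (x, y + 1)" "right_face ((x - 1, y), (x, y)) = (x, y)"
    "right_face ((x - 1, y - 1), (x, y - 1)) = (x, y - 1)" "right_face ((x, y - 1), (x - 1, y - 1)) = (x, y)"
    "right_face ((x, y), (x, y - 1)) = (x, y)" "right_face ((x, y - 1), (x, y)) = (x + 1, y)"
    "right_face ((x - 1, y - 1), (x - 1, y)) = (x, y)" "right_face ((x - 1, y), (x - 1, y - 1)) = (x - 1, y)"
  by (simp_all add: right_face_def)

lemma edge_sum_square:
  assumes C: "(x, y) \<in> internal_faces k c" and \<phi>: "square_orientation k c \<phi>"
  shows "edge_sum (right_weight \<phi> a) (x, y) (x - 1, y) = \<phi> ((x, y), (x - 1, y)) * (a (x, y + 1) - a (x, y))"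
    "edge_sum (right_weight \<phi> a) (x - 1, y - 1) (x, y - 1) = \<phi> ((x - 1, y - 1), (x, y - 1)) * (a (x, y - 1) - a (x, y))"
    "edge_sum (right_weight \<phi> a) (x, y) (x, y - 1) = \<phi> ((x, y), (x, y - 1)) * (a (x, y) - a (x + 1, y))"
    "edge_sum (right_weight \<phi> a) (x - 1, y - 1) (x - 1, y) = \<phi> ((x - 1, y - 1), (x - 1, y)) * (a (x, y) - a (x - 1, y))"
proof -
  have anti: "\<phi> (v, u) = - \<phi> (u, v)" if "(u, v) \<in> edges_in (aztec_vertices k c)" for u v
    using \<phi> that by (auto simp: square_orientation_def)
  note [simp] = face_edges_in[OF C, THEN anti] right_face_square
  show "edge_sum (right_weight \<phi> a) (x, y) (x - 1, y) = \<phi> ((x, y), (x - 1, y)) * (a (x, y + 1) - a (x, y))"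
    "edge_sum (right_weight \<phi> a) (x - 1, y - 1) (x, y - 1) = \<phi> ((x - 1, y - 1), (x, y - 1)) * (a (x, y - 1) - a (x, y))"
    "edge_sum (right_weight \<phi> a) (x, y) (x, y - 1) = \<phi> ((x, y), (x, y - 1)) * (a (x, y) - a (x + 1, y))"
    "edge_sum (right_weight \<phi> a) (x - 1, y - 1) (x - 1, y) = \<phi> ((x - 1, y - 1), (x - 1, y)) * (a (x, y) - a (x - 1, y))"
    by (simp_all add: edge_sum_def right_weight_def right_diff_distrib)
qed

text \<open>The difference of the labels of the two faces at \<open>v\<close> that are not cells.\<close>

definition gauge :: "int \<Rightarrow> (face \<Rightarrow> real) \<Rightarrow> vertex \<Rightarrow> real" where
  "gauge s a = (\<lambda>(x, y). if odd (x + y + s) then a (x + 1, y) - a (x, y + 1) else a (x + 1, y + 1) - a (x, y))"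

lemma gauge_square:
  fixes x y :: int
  assumes "odd (x + y + s)"
  shows "gauge s a (x, y) = a (x + 1, y) - a (x, y + 1)"
    "gauge s a (x - 1, y) = a (x, y + 1) - a (x - 1, y)"
    "gauge s a (x - 1, y - 1) = a (x, y - 1) - a (x - 1, y)"
    "gauge s a (x, y - 1) = a (x + 1, y) - a (x, y - 1)"
proof -
  have p: "\<not> odd (x - 1 + y + s)" "odd (x - 1 + (y - 1) + s)" "\<not> odd (x + (y - 1) + s)" using assms by presburger+
  show "gauge s a (x, y) = a (x + 1, y) - a (x, y + 1)"
    "gauge s a (x - 1, y) = a (x, y + 1) - a (x - 1, y)"
    "gauge s a (x - 1, y - 1) = a (x, y - 1) - a (x - 1, y)"
    "gauge s a (x, y - 1) = a (x + 1, y) - a (x, y - 1)"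
    unfolding gauge_def prod.case if_P[OF assms] if_P[OF p(2)] if_not_P[OF p(1)] if_not_P[OF p(3)]
    by (simp_all del: even_add)
qed

text \<open>The two inverted factors are the gauge at the ends of an edge, the third is its weight
  with the new label, and the right side is the weight of the opposite edge over the cell sum
  \<open>D\<close>. Only horizontal edges change their sign because \<open>D\<close> is both
  \<open>\<phi>N * \<phi>S\<close> and \<open>- (\<phi>E * \<phi>W)\<close> times the dSKP
  denominator.\<close>

lemma dual_weight:
  fixes \<phi>N \<phi>S \<phi>E \<phi>W :: real
  assumes d: "dskp c n e s w c'" and \<epsilon>: "\<epsilon> * \<epsilon> = (1 :: real)"
    and \<phi>: "\<phi>N \<in> {-1, 1}" "\<phi>S \<in> {-1, 1}" "\<phi>E \<in> {-1, 1}" "\<phi>W \<in> {-1, 1}" "\<phi>N * \<phi>S * (\<phi>E * \<phi>W) = -1"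
    and D: "D = \<phi>N * (n - c) * (\<phi>S * (s - c)) + \<phi>E * (c - e) * (\<phi>W * (c - w))"
  shows "D = \<phi>N * \<phi>S * dskp_delta c n e s w"
    and "inverse (\<epsilon> * (e - n)) * inverse (\<epsilon> * (n - w)) * (- \<phi>N * (n - c')) = \<phi>S * (s - c) / D"
    and "inverse (\<epsilon> * (s - w)) * inverse (\<epsilon> * (e - s)) * (- \<phi>S * (s - c')) = \<phi>N * (n - c) / D"
    and "inverse (\<epsilon> * (e - n)) * inverse (\<epsilon> * (e - s)) * (\<phi>E * (c' - e)) = \<phi>W * (c - w) / D"
    and "inverse (\<epsilon> * (s - w)) * inverse (\<epsilon> * (n - w)) * (\<phi>W * (c' - w)) = \<phi>E * (c - e) / D"
proof -
  let ?d = "dskp_delta c n e s w"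
  have d0: "?d \<noteq> 0" and ne: "e - n \<noteq> 0" "n - w \<noteq> 0" "s - w \<noteq> 0" "e - s \<noteq> 0"
    using d by (auto simp: dskp_def)
  have sq: "\<phi>N * \<phi>N = 1" "\<phi>S * \<phi>S = 1" "\<phi>E * \<phi>E = 1" "\<phi>W * \<phi>W = 1" using \<phi> by auto
  have EW: "\<phi>E * \<phi>W = - (\<phi>N * \<phi>S)" using \<phi> by auto
  have "D = \<phi>N * \<phi>S * ((n - c) * (s - c)) + \<phi>E * \<phi>W * ((c - e) * (c - w))" unfolding D by algebra
  then show D': "D = \<phi>N * \<phi>S * ?d" unfolding EW dskp_delta_def by algebra
  have D2: "D = - (\<phi>E * \<phi>W) * ?d" unfolding EW D' by simp
  have D0: "D \<noteq> 0" using D' d0 sq by auto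
  have ie: "inverse (\<epsilon> * p) * inverse (\<epsilon> * q) = inverse (p * q)" for p q
  proof -
    have "inverse (\<epsilon> * p) * inverse (\<epsilon> * q) = inverse (\<epsilon> * \<epsilon> * (p * q))"
      by (simp add: inverse_mult_distrib mult.commute mult.left_commute)
    then show ?thesis using \<epsilon> by simp
  qed
  have frac: "inverse (p * q) * r = t / D" if "r * D = t * (p * q)" "p \<noteq> 0" "q \<noteq> 0" for p q r t
    using that D0 by (simp add: field_simps)
  note diff = dskp_diff[OF d]
  show "inverse (\<epsilon> * (e - n)) * inverse (\<epsilon> * (n - w)) * (- \<phi>N * (n - c')) = \<phi>S * (s - c) / D"
    unfolding ie
  proof (rule frac)
    have "- \<phi>N * (n - c') * D = \<phi>N * \<phi>N * \<phi>S * ((c' - n) * ?d)" unfolding D' by algebra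
    then show "- \<phi>N * (n - c') * D = \<phi>S * (s - c) * ((e - n) * (n - w))" unfolding diff sq by algebra
  qed (use ne in auto)
  show "inverse (\<epsilon> * (s - w)) * inverse (\<epsilon> * (e - s)) * (- \<phi>S * (s - c')) = \<phi>N * (n - c) / D"
    unfolding ie
  proof (rule frac)
    have "- \<phi>S * (s - c') * D = \<phi>S * \<phi>S * \<phi>N * ((c' - s) * ?d)" unfolding D' by algebra
    then show "- \<phi>S * (s - c') * D = \<phi>N * (n - c) * ((s - w) * (e - s))" unfolding diff sq by algebra
  qed (use ne in auto)
  show "inverse (\<epsilon> * (e - n)) * inverse (\<epsilon> * (e - s)) * (\<phi>E * (c' - e)) = \<phi>W * (c - w) / D"
    unfolding ie
  proof (rule frac)
    have "\<phi>E * (c' - e) * D = - (\<phi>E * \<phi>E * \<phi>W * ((c' - e) * ?d))" unfolding D2 by algebra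
    then show "\<phi>E * (c' - e) * D = \<phi>W * (c - w) * ((e - n) * (e - s))" unfolding diff sq by algebra
  qed (use ne in auto)
  show "inverse (\<epsilon> * (s - w)) * inverse (\<epsilon> * (n - w)) * (\<phi>W * (c' - w)) = \<phi>E * (c - e) / D"
    unfolding ie
  proof (rule frac)
    have "\<phi>W * (c' - w) * D = - (\<phi>W * \<phi>W * \<phi>E * ((c' - w) * ?d))" unfolding D2 by algebra
    then show "\<phi>W * (c' - w) * D = \<phi>E * (c - e) * ((s - w) * (n - w))" unfolding diff sq by algebra
  qed (use ne in auto)
qed

text \<open>The sign \<open>\<epsilon>\<close> of the gauge cancels on every edge; \<open>-1\<close> is the convenient choice for the inverse
  labels.\<close>

lemma dimer_Z_Suc:
  assumes \<phi>: "square_orientation (Suc k) (p, q) \<phi>" and \<epsilon>: "\<epsilon> * \<epsilon> = (1 :: real)"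
    and d: "\<And>x y. (x, y) \<in> aztec_cells (Suc k) (p, q) \<Longrightarrow>
        dskp (a (x, y)) (a (x, y + 1)) (a (x + 1, y)) (a (x, y - 1)) (a (x - 1, y)) (a' (x, y))"
    and a': "\<And>x y. even (x + y + (p + q + int (Suc k))) \<Longrightarrow> a' (x, y) = a (x, y)"
  shows "dimer_Z (Suc k) (p, q) a \<phi> =
      (\<Prod>(x, y)\<in>aztec_cells (Suc k) (p, q). \<phi> ((x, y), (x - 1, y)) * \<phi> ((x - 1, y - 1), (x, y - 1))
         * dskp_delta (a (x, y)) (a (x, y + 1)) (a (x + 1, y)) (a (x, y - 1)) (a (x - 1, y)))
      * (\<Prod>v\<in>aztec_vertices k (p, q). inverse (\<epsilon> * gauge (p + q + int (Suc k)) a v))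
      * dimer_Z k (p, q) a' (flip_horizontal \<phi>)"
proof -
  let ?s = "p + q + int (Suc k)" and ?c = "(p, q)"
  define g where "g v = inverse (\<epsilon> * gauge ?s a v)" for v
  define w' where "w' = (\<lambda>(u, v). g u * g v * right_weight (flip_horizontal \<phi>) a' (u, v))"
  let ?w = "right_weight \<phi> a"
  have w'_sum: "edge_sum w' u v = g u * g v * edge_sum (right_weight (flip_horizontal \<phi>) a') u v" for u v
    by (simp add: w'_def edge_sum_def algebra_simps)
  have anti: "\<phi> (v, u) = - \<phi> (u, v)" and pm: "\<phi> (u, v) \<in> {-1, 1}"
    if "(u, v) \<in> edges_in (aztec_vertices (Suc k) ?c)" for u v
    using \<phi> that unfolding square_orientation_def by blast+
  have *: "cell_sum ?w (x, y) = \<phi> ((x, y), (x - 1, y)) * \<phi> ((x - 1, y - 1), (x, y - 1))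
         * dskp_delta (a (x, y)) (a (x, y + 1)) (a (x + 1, y)) (a (x, y - 1)) (a (x - 1, y)) \<and>
      cell_sum ?w (x, y) \<noteq> 0 \<and>
        edge_sum w' (x, y) (x - 1, y) = edge_sum ?w (x - 1, y - 1) (x, y - 1) / cell_sum ?w (x, y) \<and>
        edge_sum w' (x - 1, y - 1) (x, y - 1) = edge_sum ?w (x, y) (x - 1, y) / cell_sum ?w (x, y) \<and>
        edge_sum w' (x, y) (x, y - 1) = edge_sum ?w (x - 1, y - 1) (x - 1, y) / cell_sum ?w (x, y) \<and>
        edge_sum w' (x - 1, y - 1) (x - 1, y) = edge_sum ?w (x, y) (x, y - 1) / cell_sum ?w (x, y)"
    if C: "(x, y) \<in> aztec_cells (Suc k) ?c" for x y
  proof -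
    have Ci: "(x, y) \<in> internal_faces (Suc k) ?c" using C aztec_cells_subset by blast
    have odd: "odd (x + y + ?s)" using C unfolding mem_aztec_cells by blast
    \<comment> \<open>Neighbours of a cell are not cells, so \<open>a'\<close> agrees with
      \<open>a\<close> there.\<close>
    have ev: "even (x + (y + 1) + ?s)" "even (x + 1 + y + ?s)" "even (x + (y - 1) + ?s)" "even (x - 1 + y + ?s)"
      using odd by presburger+
    note E = face_edges_in[OF Ci]
    note es = edge_sum_square[OF Ci \<phi>, of a]
    have fes: "edge_sum (right_weight (flip_horizontal \<phi>) b) (x, y) (x - 1, y) = - \<phi> ((x, y), (x - 1, y)) * (b (x, y + 1) - b (x, y))"
      "edge_sum (right_weight (flip_horizontal \<phi>) b) (x - 1, y - 1) (x, y - 1) = - \<phi> ((x - 1, y - 1), (x, y - 1)) * (b (x, y - 1) - b (x, y))"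
      "edge_sum (right_weight (flip_horizontal \<phi>) b) (x, y) (x, y - 1) = \<phi> ((x, y), (x, y - 1)) * (b (x, y) - b (x + 1, y))"
      "edge_sum (right_weight (flip_horizontal \<phi>) b) (x - 1, y - 1) (x - 1, y) = \<phi> ((x - 1, y - 1), (x - 1, y)) * (b (x, y) - b (x - 1, y))" for b
      by (simp_all add: edge_sum_def right_weight_def flip_horizontal_def right_face_square
          anti[OF E(1)] anti[OF E(2)] anti[OF E(3)] anti[OF E(4)] algebra_simps)
    have prod: "\<phi> ((x, y), (x - 1, y)) * \<phi> ((x - 1, y - 1), (x, y - 1))
        * (\<phi> ((x, y), (x, y - 1)) * \<phi> ((x - 1, y - 1), (x - 1, y))) = -1"
      using \<phi> Ci unfolding square_orientation_def by blast
    have D: "cell_sum ?w (x, y) = \<phi> ((x, y), (x - 1, y)) * (a (x, y + 1) - a (x, y))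
          * (\<phi> ((x - 1, y - 1), (x, y - 1)) * (a (x, y - 1) - a (x, y)))
        + \<phi> ((x, y), (x, y - 1)) * (a (x, y) - a (x + 1, y))
          * (\<phi> ((x - 1, y - 1), (x - 1, y)) * (a (x, y) - a (x - 1, y)))"
      unfolding cell_sum_def prod.case es ..
    note dw = dual_weight[OF d[OF C] \<epsilon> pm[OF E(1)] pm[OF E(2)] pm[OF E(3)] pm[OF E(4)] prod D]
    have "cell_sum ?w (x, y) \<noteq> 0"
      unfolding dw(1) using pm[OF E(1)] pm[OF E(2)] d[OF C] by (auto simp: dskp_def)
    then show ?thesis
      using dw unfolding w'_sum fes es g_def gauge_square[OF odd] a'[OF ev(1)] a'[OF ev(2)] a'[OF ev(3)] a'[OF ev(4)]
      by blast
  qed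
  have "dimer_Z (Suc k) ?c a \<phi> = cover_sum (aztec_vertices (Suc k) ?c) ?w"
    unfolding dimer_Z_eq right_weight_def ..
  also have "\<dots> = (\<Prod>C\<in>aztec_cells (Suc k) ?c. cell_sum ?w C) * cover_sum (aztec_vertices k ?c) w'"
  proof (rule cover_sum_aztec_Suc)
    fix C assume C: "C \<in> aztec_cells (Suc k) ?c"
    obtain x y where xy: "C = (x, y)" by fastforce
    show "cell_sum ?w C \<noteq> 0" using *[of x y] C unfolding xy by blast
  qed (use * in blast)
  also have "cover_sum (aztec_vertices k ?c) w'
      = (\<Prod>v\<in>aztec_vertices k ?c. g v) * cover_sum (aztec_vertices k ?c) (right_weight (flip_horizontal \<phi>) a')"
    by (rule cover_sum_gauge[OF finite_aztec_vertices]) (simp add: w'_def algebra_simps)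
  also have "cover_sum (aztec_vertices k ?c) (right_weight (flip_horizontal \<phi>) a') = dimer_Z k ?c a' (flip_horizontal \<phi>)"
    unfolding dimer_Z_eq right_weight_def ..
  also have "(\<Prod>C\<in>aztec_cells (Suc k) ?c. cell_sum ?w C)
      = (\<Prod>(x, y)\<in>aztec_cells (Suc k) ?c. \<phi> ((x, y), (x - 1, y)) * \<phi> ((x - 1, y - 1), (x, y - 1))
         * dskp_delta (a (x, y)) (a (x, y + 1)) (a (x + 1, y)) (a (x, y - 1)) (a (x - 1, y)))"
    by (rule prod.cong[OF refl]) (use * in auto)
  finally show ?thesis by (simp add: g_def mult.assoc)
qed

section \<open>Exponents of the labels and invariance of the ratio\<close>

lemma card_filter_insert:
  assumes "finite A" "b \<notin> A"
  shows "card {x \<in> insert b A. P x} = of_bool (P b) + card {x \<in> A. P x}"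
proof -
  have "{x \<in> insert b A. P x} = (if P b then insert b {x \<in> A. P x} else {x \<in> A. P x})" by auto
  then show ?thesis using assms by simp
qed

lemma card_filter_four:
  assumes "distinct [a, b, c, d]"
  shows "card {x \<in> {a, b, c, d}. P x} = of_bool (P a) + of_bool (P b) + of_bool (P c) + of_bool (P d)"
proof -
  have "card {x \<in> {a, b, c, d}. P x}
      = of_bool (P a) + (of_bool (P b) + (of_bool (P c) + (of_bool (P d) + card {x \<in> {}. P x})))"
    using assms by (subst card_filter_insert, force, force)+ (rule refl)
  then show ?thesis by simp
qed

lemma aztec_cells_mono: "aztec_cells k c \<subseteq> aztec_cells (Suc (Suc k)) c"
  by (cases c) (auto simp: mem_aztec_cells)

lemma odd_dist_neq:
  fixes X Y k :: int
  assumes "odd (X + Y + k)"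
  shows "\<bar>X\<bar> + \<bar>Y\<bar> \<noteq> k"
proof
  assume "\<bar>X\<bar> + \<bar>Y\<bar> = k"
  then have "odd (X + Y + (\<bar>X\<bar> + \<bar>Y\<bar>))" using assms by simp
  then show False by (cases X rule: abs_succ_int; cases Y rule: abs_succ_int) simp_all
qed

text \<open>Open faces have the parity of the cells of size \<open>Suc k\<close>; faces of the other
  parity are never at distance exactly \<open>k\<close>.\<close>

lemma aztec_faces_eq: "aztec_faces k c = aztec_cells (Suc k) c \<union> aztec_cells k c"
proof -
  obtain p q where c: "c = (p, q)" by fastforce
  have "(x, y) \<in> aztec_faces k c \<longleftrightarrow> (x, y) \<in> aztec_cells (Suc k) c \<union> aztec_cells k c" for x y
  proof (cases "odd (x + y + (p + q + int k))")
    case True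
    then have *: "\<not> odd (x + y + (p + q + int (Suc k)))" "odd (x - p + (y - q) + int k)" by presburger+
    show ?thesis using True *(1) odd_dist_neq[OF *(2)]
      unfolding c aztec_faces_def internal_faces_def open_faces_def Un_iff prod.case mem_Collect_eq mem_aztec_cells
      by blast
  next
    case False
    then have "odd (x + y + (p + q + int (Suc k)))" by presburger
    moreover have "m < int (Suc k) \<longleftrightarrow> m < int k \<or> m = int k" for m by auto
    ultimately show ?thesis using False
      unfolding c aztec_faces_def internal_faces_def open_faces_def Un_iff prod.case mem_Collect_eq mem_aztec_cells
      by blast
  qed
  then show ?thesis by auto
qed

lemma aztec_cells_disjoint: "aztec_cells (Suc k) c \<inter> aztec_cells k c = {}"
proof -
  obtain p q where c: "c = (p, q)" by fastforce
  have "False" if "odd (x + y + (p + q + int (Suc k)))" "odd (x + y + (p + q + int k))" for x y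
    using that by presburger
  then have "(x, y) \<notin> aztec_cells (Suc k) c \<inter> aztec_cells k c" for x y
    unfolding c Int_iff mem_aztec_cells by blast
  then show ?thesis by (intro equals0I) (metis surj_pair)
qed

text \<open>The booleans say which neighbours of the face at position \<open>(X, Y)\<close> from the centre are cells. A
  corner of that face is a vertex of the next smaller diamond iff both neighbours at the corner are
  cells. The equation compares the exponents of the label of the face in \<open>aztec_weight_count\<close>.\<close>

lemma aztec_incidence_count:
  fixes X Y k :: int
  assumes NESW: "N = (\<bar>X\<bar> + \<bar>Y + 1\<bar> \<le> k)" "E = (\<bar>X + 1\<bar> + \<bar>Y\<bar> \<le> k)"
      "S = (\<bar>X\<bar> + \<bar>Y - 1\<bar> \<le> k)" "W = (\<bar>X - 1\<bar> + \<bar>Y\<bar> \<le> k)"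
    and hyp: "\<bar>X\<bar> + \<bar>Y\<bar> \<le> k + 1" "odd (X + Y + k)" "0 \<le> k"
  shows "1 + (of_bool (E \<and> N) + of_bool (W \<and> N) + of_bool (W \<and> S) + of_bool (E \<and> S)) 
     = of_bool N + of_bool E + of_bool S + of_bool W + (of_bool (\<bar>X\<bar> + \<bar>Y\<bar> < k) :: nat)"
proof (cases "\<bar>X\<bar> + \<bar>Y\<bar> < k")
  case True
  then have "N" "E" "S" "W" using NESW by auto
  then show ?thesis using True by simp
next
  case False
  have "\<bar>X\<bar> + \<bar>Y\<bar> \<noteq> k" using odd_dist_neq[OF hyp(2)] .
  then have k: "k = \<bar>X\<bar> + \<bar>Y\<bar> - 1" using False hyp(1) by linarith
  have "N = (Y < 0)" "S = (Y > 0)" "E = (X < 0)" "W = (X > 0)"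
    unfolding NESW k by arith+
  moreover have "X \<noteq> 0 \<or> Y \<noteq> 0" using k hyp(3) by auto
  ultimately show ?thesis using False by (cases "X < 0"; cases "X = 0"; cases "Y < 0"; cases "Y = 0") simp_all
qed

text \<open>The monomial identity behind the invariance of the ratio. \<open>h\<close> comes from
  the gauge of the inverse labels, the product over neighbours from the factors in
  \<open>dskp_inverse\<close>, and the other two products run over the faces of the larger and of
  the smaller diamond that are not renewed. Everything is rewritten as a product over
  \<open>aztec_cells (Suc (Suc k))\<close>, and the exponents are compared face by face.\<close>

lemma aztec_weight_count:
  fixes a :: "face \<Rightarrow> real" and p q :: int and k :: nat
  defines "h \<equiv> \<lambda>v. a (cell_a (p + q + int k) v) * a (cell_b (p + q + int k) v)"
  shows "(\<Prod>f\<in>aztec_cells (Suc (Suc k)) (p, q). a f) * (\<Prod>v\<in>aztec_vertices k (p, q). h v)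
    = (\<Prod>(x, y)\<in>aztec_cells (Suc k) (p, q). a (x, y + 1) * a (x + 1, y) * a (x, y - 1) * a (x - 1, y))
      * (\<Prod>f\<in>aztec_cells k (p, q). a f)"
proof -
  let ?c = "(p, q)"
  let ?L = "aztec_cells (Suc (Suc k)) ?c" and ?I = "aztec_cells (Suc k) ?c" and ?V = "aztec_vertices k ?c"
  have par2: "odd (m + (p + q + int (Suc (Suc k)))) \<longleftrightarrow> odd (m + (p + q + int k))" for m by presburger
  have cell2: "cell_a (p + q + int (Suc (Suc k))) = cell_a (p + q + int k)"
    "cell_b (p + q + int (Suc (Suc k))) = cell_b (p + q + int k)"
    unfolding cell_a_def cell_b_def par2 by (rule refl)+
  have V: "(\<Prod>v\<in>?V. h v) = (\<Prod>f\<in>?L. a f ^ card {v \<in> ?V. v \<in> face_vertices f})"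
  proof -
    have "h v = (\<Prod>f\<in>{f \<in> ?L. v \<in> face_vertices f}. a f)" if v: "v \<in> ?V" for v
    proof -
      have "v \<in> aztec_vertices (Suc k) ?c" using v aztec_vertices_mono by blast
      then have "cell_a (p + q + int k) v \<in> ?L" "cell_b (p + q + int k) v \<in> ?L"
        unfolding aztec_vertices_cells(2)[of v "Suc k"] cell2 by blast+
      then have "{f \<in> ?L. v \<in> face_vertices f} = {cell_a (p + q + int k) v, cell_b (p + q + int k) v}"
        using mem_face_vertices_cell[of _ "Suc (Suc k)" p q v, unfolded cell2] by blast
      then show ?thesis by (simp add: h_def cell_a_neq_cell_b)
    qed
    then have "(\<Prod>v\<in>?V. h v) = (\<Prod>v\<in>?V. \<Prod>f\<in>{f \<in> ?L. v \<in> face_vertices f}. a f)" by simp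
    also have "\<dots> = (\<Prod>f\<in>?L. \<Prod>v\<in>{v \<in> ?V. v \<in> face_vertices f}. a f)"
      by (rule prod.swap_restrict) (simp_all add: finite_aztec_vertices finite_aztec_cells)
    finally show ?thesis by simp
  qed
  have I: "(\<Prod>(x, y)\<in>?I. a (x, y + 1) * a (x + 1, y) * a (x, y - 1) * a (x - 1, y))
      = (\<Prod>f\<in>?L. a f ^ card {C \<in> ?I. adjacent C f})"
  proof -
    have "(case C of (x, y) \<Rightarrow> a (x, y + 1) * a (x + 1, y) * a (x, y - 1) * a (x - 1, y))
        = (\<Prod>f\<in>{f \<in> ?L. adjacent C f}. a f)" if C: "C \<in> ?I" for C
    proof -
      obtain x y where xy: "C = (x, y)" by fastforce
      have d: "\<bar>x - p\<bar> + \<bar>y - q\<bar> < int (Suc k)" and o: "odd (x + y + (p + q + int (Suc k)))"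
        using C unfolding xy mem_aztec_cells by blast+
      have "odd (x + (y + 1) + (p + q + int (Suc (Suc k))))" "odd (x + 1 + y + (p + q + int (Suc (Suc k))))"
        "odd (x + (y - 1) + (p + q + int (Suc (Suc k))))" "odd (x - 1 + y + (p + q + int (Suc (Suc k))))"
        using o by presburger+
      moreover have "\<bar>x - p\<bar> + \<bar>y + 1 - q\<bar> < int (Suc (Suc k))" "\<bar>x + 1 - p\<bar> + \<bar>y - q\<bar> < int (Suc (Suc k))"
        "\<bar>x - p\<bar> + \<bar>y - 1 - q\<bar> < int (Suc (Suc k))" "\<bar>x - 1 - p\<bar> + \<bar>y - q\<bar> < int (Suc (Suc k))"
        using d by (simp_all add: abs_if split: if_splits)
      ultimately have "{(x, y + 1), (x + 1, y), (x, y - 1), (x - 1, y)} \<subseteq> ?L"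
        unfolding insert_subset mem_aztec_cells by blast
      moreover have "adjacent C f \<longleftrightarrow> f \<in> {(x, y + 1), (x + 1, y), (x, y - 1), (x - 1, y)}" for f
        by (cases f) (auto simp: xy adjacent_def)
      ultimately have "{f \<in> ?L. adjacent C f} = {(x, y + 1), (x + 1, y), (x, y - 1), (x - 1, y)}" by blast
      then show ?thesis by (simp add: xy)
    qed
    then have "(\<Prod>(x, y)\<in>?I. a (x, y + 1) * a (x + 1, y) * a (x, y - 1) * a (x - 1, y))
        = (\<Prod>C\<in>?I. \<Prod>f\<in>{f \<in> ?L. adjacent C f}. a f)" by (intro prod.cong refl)
    also have "\<dots> = (\<Prod>f\<in>?L. \<Prod>C\<in>{C \<in> ?I. adjacent C f}. a f)"
      by (rule prod.swap_restrict) (simp_all add: finite_aztec_cells)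
    finally show ?thesis by simp
  qed
  have K: "(\<Prod>f\<in>aztec_cells k ?c. a f) = (\<Prod>f\<in>?L. a f ^ of_bool (f \<in> aztec_cells k ?c))"
    using aztec_cells_mono[of k ?c]
    by (intro prod.mono_neutral_cong_left) (auto simp: finite_aztec_cells)
  have cnt: "1 + card {v \<in> ?V. v \<in> face_vertices f} = card {C \<in> ?I. adjacent C f} + of_bool (f \<in> aztec_cells k ?c)"
    if f: "f \<in> ?L" for f
  proof -
    obtain x y where xy: "f = (x, y)" by fastforce
    have d: "\<bar>x - p\<bar> + \<bar>y - q\<bar> < int (Suc (Suc k))" and o2: "odd (x + y + (p + q + int (Suc (Suc k))))"
      using f unfolding xy mem_aztec_cells by blast+
    let ?s = "p + q + int (Suc k)"
    have o: "odd (x + (y + 1) + ?s)" "odd (x + 1 + y + ?s)" "odd (x + (y - 1) + ?s)" "odd (x - 1 + y + ?s)"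
      "odd (x + y + (p + q + int k))" "odd (x - p + (y - q) + int k)"
      "\<not> odd (x + y + ?s)" "\<not> odd (x - 1 + (y - 1) + ?s)"
      using o2 by presburger+
    define N where "N \<longleftrightarrow> (x, y + 1) \<in> ?I"
    define E where "E \<longleftrightarrow> (x + 1, y) \<in> ?I"
    define S where "S \<longleftrightarrow> (x, y - 1) \<in> ?I"
    define W where "W \<longleftrightarrow> (x - 1, y) \<in> ?I"
    have corner: "(x, y) \<in> ?V \<longleftrightarrow> E \<and> N" "(x - 1, y) \<in> ?V \<longleftrightarrow> W \<and> N"
      "(x - 1, y - 1) \<in> ?V \<longleftrightarrow> W \<and> S" "(x, y - 1) \<in> ?V \<longleftrightarrow> E \<and> S"
      unfolding aztec_vertices_cells(2) cell_a_def cell_b_def prod.case N_def E_def S_def W_def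
        if_P[OF o(3)] if_P[OF o(4)] if_not_P[OF o(7)] if_not_P[OF o(8)] by (simp_all del: even_add; blast)+
    have v: "v \<in> face_vertices f \<longleftrightarrow> v = (x, y) \<or> v = (x - 1, y) \<or> v = (x - 1, y - 1) \<or> v = (x, y - 1)" for v
      by (cases v) (auto simp: xy face_vertices_def)
    have "{v \<in> ?V. v \<in> face_vertices f}
        = {v \<in> {(x, y), (x - 1, y), (x - 1, y - 1), (x, y - 1)}. v \<in> ?V}"
      using v by blast
    then have cV: "card {v \<in> ?V. v \<in> face_vertices f}
        = of_bool (E \<and> N) + of_bool (W \<and> N) + of_bool (W \<and> S) + of_bool (E \<and> S)"
      by (simp only:) (subst card_filter_four, simp, simp only: corner)
    have adj: "adjacent C f \<longleftrightarrow> C = (x, y + 1) \<or> C = (x + 1, y) \<or> C = (x, y - 1) \<or> C = (x - 1, y)" for C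
      by (cases C) (auto simp: xy adjacent_def)
    have "{C \<in> ?I. adjacent C f}
        = {C \<in> {(x, y + 1), (x + 1, y), (x, y - 1), (x - 1, y)}. C \<in> ?I}"
      using adj by blast
    then have cI: "card {C \<in> ?I. adjacent C f} = of_bool N + of_bool E + of_bool S + of_bool W"
      by (simp only:) (subst card_filter_four, simp, simp only: N_def E_def S_def W_def)
    have lt: "m < int (Suc k) \<longleftrightarrow> m \<le> int k" for m by auto
    have e: "y - 1 - q = y - q - 1" "x - 1 - p = x - p - 1" "y + 1 - q = y - q + 1" "x + 1 - p = x - p + 1"
      by simp_all
    have NESW: "N = (\<bar>x - p\<bar> + \<bar>y - q + 1\<bar> \<le> int k)" "E = (\<bar>x - p + 1\<bar> + \<bar>y - q\<bar> \<le> int k)"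
      "S = (\<bar>x - p\<bar> + \<bar>y - q - 1\<bar> \<le> int k)" "W = (\<bar>x - p - 1\<bar> + \<bar>y - q\<bar> \<le> int k)"
      unfolding N_def E_def S_def W_def mem_aztec_cells lt e using o(1-4) by blast+
    have k: "f \<in> aztec_cells k ?c \<longleftrightarrow> \<bar>x - p\<bar> + \<bar>y - q\<bar> < int k"
      unfolding xy mem_aztec_cells using o(5) by blast
    have "\<bar>x - p\<bar> + \<bar>y - q\<bar> \<le> int k + 1" using d by simp
    from aztec_incidence_count[OF NESW this o(6) of_nat_0_le_iff] show ?thesis
      unfolding cV cI k .
  qed
  have "a f * a f ^ card {v \<in> ?V. v \<in> face_vertices f}
      = a f ^ card {C \<in> ?I. adjacent C f} * a f ^ of_bool (f \<in> aztec_cells k ?c)" if "f \<in> ?L" for f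
    unfolding power_add[symmetric] cnt[OF that, symmetric] by simp
  then show ?thesis unfolding V I K prod.distrib[symmetric] by (rule prod.cong[OF refl])
qed

text \<open>\<open>X n (x, y)\<close> is meaningful for even \<open>x + y + int n\<close> only. A
  slice is the staircase of the levels \<open>n\<close> and \<open>Suc n\<close>; the next slice
  replaces the labels of level \<open>n\<close> by those of level \<open>Suc (Suc n)\<close> at the
  same faces and keeps the others.\<close>

definition lattice_slice :: "(nat \<Rightarrow> face \<Rightarrow> real) \<Rightarrow> nat \<Rightarrow> face \<Rightarrow> real" where
  "lattice_slice X n = (\<lambda>(x, y). X (if even (x + y + int n) then n else Suc n) (x, y))"

lemma dimer_Z_0: "dimer_Z 0 c a \<phi> = 1"
proof -
  have "aztec_vertices 0 c = {}" by (auto simp: aztec_vertices_def internal_faces_def)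
  then show ?thesis by (simp add: dimer_Z_eq cover_sum_empty)
qed

lemma aztec_faces_0: "aztec_faces 0 c = {c}"
  by (cases c) (auto simp: aztec_faces_def internal_faces_def open_faces_def)

text \<open>Size 0 is no exception to the general formula: the empty diamond has dimer sum 1, and
  its only face is the centre.\<close>

lemma dimer_Y_eq:
  "dimer_Y k c a \<phi> = (\<Prod>d\<in>aztec_faces k c. a d) * (dimer_Z k c (\<lambda>d. inverse (a d)) \<phi> / dimer_Z k c a \<phi>)"
  by (simp add: dimer_Y_def dimer_Z_0 aztec_faces_0)

text \<open>Free of division by \<open>dimer_Z\<close>, so that the identity can be carried to a
  limit. One renewal moves the slice up by one level and shrinks the diamond by one, so the level
  \<open>n + k + 1\<close> of the apex stays fixed while \<open>n\<close> and the orientation vary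
  in the induction.\<close>

lemma dskp_dimer_ratio:
  fixes X :: "nat \<Rightarrow> face \<Rightarrow> real"
  assumes nz: "\<And>n x y. even (x + y + int n) \<Longrightarrow> X n (x, y) \<noteq> 0"
    and d: "\<And>n x y. even (x + y + int n) \<Longrightarrow>
        dskp (X n (x, y)) (X (Suc n) (x, y + 1)) (X (Suc n) (x + 1, y))
          (X (Suc n) (x, y - 1)) (X (Suc n) (x - 1, y)) (X (Suc (Suc n)) (x, y))"
    and "even (p + q + int (n + k + 1))" "square_orientation k (p, q) \<phi>"
  shows "X (n + k + 1) (p, q) * dimer_Z k (p, q) (lattice_slice X n) \<phi>
    = (\<Prod>d\<in>aztec_faces k (p, q). lattice_slice X n d)
      * dimer_Z k (p, q) (\<lambda>d. inverse (lattice_slice X n d)) \<phi>"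
  using assms(3,4)
proof (induction k arbitrary: n \<phi>)
  case 0
  have "\<not> even (p + q + int n)" using 0(1) by simp
  then have "lattice_slice X n (p, q) = X (Suc n) (p, q)"
    unfolding lattice_slice_def prod.case by (rule arg_cong[where f = "\<lambda>m. X m (p, q)", OF if_not_P])
  then show ?case by (simp add: dimer_Z_0 aztec_faces_0)
next
  case (Suc k)
  let ?c = "(p, q)" and ?s = "p + q + int (Suc k)"
  let ?I = "aztec_cells (Suc k) ?c"
  let ?a = "lattice_slice X n" and ?a' = "lattice_slice X (Suc n)"
  let ?ia = "\<lambda>d. inverse (?a d)" and ?ia' = "\<lambda>d. inverse (?a' d)"
  have slice_nz: "lattice_slice X m d \<noteq> 0" for m d
  proof (cases d)
    case (Pair x y)
    then show ?thesis
      using nz[of x y m] nz[of x y "Suc m"] unfolding lattice_slice_def by (cases "even (x + y + int m)") auto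
  qed
  have cell: "?a (x, y) = X n (x, y)" "?a' (x, y) = X (Suc (Suc n)) (x, y)" if "odd (x + y + ?s)" for x y
  proof -
    have "even (x + y + int n)" "\<not> even (x + y + int (Suc n))"
      using that Suc.prems(1) by presburger+
    then show "?a (x, y) = X n (x, y)" "?a' (x, y) = X (Suc (Suc n)) (x, y)"
      unfolding lattice_slice_def prod.case by (simp_all only: if_True if_False simp_thms)
  qed
  have noncell: "?a (x, y) = X (Suc n) (x, y)" "?a' (x, y) = X (Suc n) (x, y)" if "even (x + y + ?s)" for x y
  proof -
    have "\<not> even (x + y + int n)" "even (x + y + int (Suc n))"
      using that Suc.prems(1) by presburger+
    then show "?a (x, y) = X (Suc n) (x, y)" "?a' (x, y) = X (Suc n) (x, y)"
      unfolding lattice_slice_def prod.case by (simp_all only: if_True if_False simp_thms)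
  qed
  have dC: "dskp (?a (x, y)) (?a (x, y + 1)) (?a (x + 1, y)) (?a (x, y - 1)) (?a (x - 1, y)) (?a' (x, y))"
    if "(x, y) \<in> ?I" for x y
  proof -
    have o: "odd (x + y + ?s)" using that unfolding mem_aztec_cells by blast
    have "even (x + (y + 1) + ?s)" "even (x + 1 + y + ?s)" "even (x + (y - 1) + ?s)" "even (x - 1 + y + ?s)"
      "even (x + y + int n)"
      using o Suc.prems(1) by presburger+
    then show ?thesis using d[of x y n] by (simp only: cell[OF o] noncell)
  qed
  have same: "?a' (x, y) = ?a (x, y)" if "even (x + y + ?s)" for x y
    using noncell[OF that] by simp
  let ?\<sigma> = "\<lambda>(x, y). \<phi> ((x, y), (x - 1, y)) * \<phi> ((x - 1, y - 1), (x, y - 1))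
         * dskp_delta (?a (x, y)) (?a (x, y + 1)) (?a (x + 1, y)) (?a (x, y - 1)) (?a (x - 1, y))"
  let ?r = "\<lambda>(x, y). ?a' (x, y) / (?a (x, y) * (?a (x, y + 1) * ?a (x + 1, y) * ?a (x, y - 1) * ?a (x - 1, y)))"
  let ?g = "\<lambda>v. inverse (gauge ?s ?a v)"
  let ?h = "\<lambda>v. ?a (cell_a (p + q + int k) v) * ?a (cell_b (p + q + int k) v)"
  have Z: "dimer_Z (Suc k) ?c ?a \<phi> = (\<Prod>C\<in>?I. ?\<sigma> C) * (\<Prod>v\<in>aztec_vertices k ?c. ?g v)
      * dimer_Z k ?c ?a' (flip_horizontal \<phi>)"
    using dimer_Z_Suc[OF Suc.prems(2), of 1 ?a ?a'] dC same by simp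
  have "dimer_Z (Suc k) ?c ?ia \<phi> =
      (\<Prod>(x, y)\<in>?I. \<phi> ((x, y), (x - 1, y)) * \<phi> ((x - 1, y - 1), (x, y - 1))
         * dskp_delta (?ia (x, y)) (?ia (x, y + 1)) (?ia (x + 1, y)) (?ia (x, y - 1)) (?ia (x - 1, y)))
      * (\<Prod>v\<in>aztec_vertices k ?c. inverse (- 1 * gauge ?s ?ia v))
      * dimer_Z k ?c ?ia' (flip_horizontal \<phi>)"
  proof (rule dimer_Z_Suc[OF Suc.prems(2)])
    show "(- 1) * (- 1) = (1 :: real)" by simp
    show "dskp (?ia (x, y)) (?ia (x, y + 1)) (?ia (x + 1, y)) (?ia (x, y - 1)) (?ia (x - 1, y)) (?ia' (x, y))"
      if "(x, y) \<in> ?I" for x y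
      by (rule dskp_inverse(2)[OF dC[OF that]]) (rule slice_nz)+
    show "?ia' (x, y) = ?ia (x, y)" if "even (x + y + ?s)" for x y using same[OF that] by simp
  qed
  also have "(\<Prod>(x, y)\<in>?I. \<phi> ((x, y), (x - 1, y)) * \<phi> ((x - 1, y - 1), (x, y - 1))
         * dskp_delta (?ia (x, y)) (?ia (x, y + 1)) (?ia (x + 1, y)) (?ia (x, y - 1)) (?ia (x - 1, y)))
      = (\<Prod>C\<in>?I. ?\<sigma> C * ?r C)"
  proof (rule prod.cong[OF refl])
    fix C assume C: "C \<in> ?I"
    obtain x y where xy: "C = (x, y)" by fastforce
    show "(case C of (x, y) \<Rightarrow> \<phi> ((x, y), (x - 1, y)) * \<phi> ((x - 1, y - 1), (x, y - 1))
         * dskp_delta (?ia (x, y)) (?ia (x, y + 1)) (?ia (x + 1, y)) (?ia (x, y - 1)) (?ia (x - 1, y)))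
         = ?\<sigma> C * ?r C"
      unfolding xy prod.case
        dskp_inverse(1)[OF dC[OF C[unfolded xy]] slice_nz slice_nz slice_nz slice_nz slice_nz slice_nz]
      by (simp add: mult.assoc)
  qed
  also have "\<dots> = (\<Prod>C\<in>?I. ?\<sigma> C) * (\<Prod>C\<in>?I. ?r C)" by (rule prod.distrib)
  also have "(\<Prod>v\<in>aztec_vertices k ?c. inverse (- 1 * gauge ?s ?ia v))
      = (\<Prod>v\<in>aztec_vertices k ?c. ?g v * ?h v)"
  proof (rule prod.cong[OF refl])
    fix v :: vertex
    obtain x y where xy: "v = (x, y)" by fastforce
    have inv: "inverse (- 1 * (inverse s - inverse t)) = inverse (s - t) * (s * t)"
      if "s \<noteq> 0" "t \<noteq> 0" for s t :: real
    proof -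
      have "- 1 * (inverse s - inverse t) = (s - t) / (s * t)" using that by (simp add: field_simps)
      then show ?thesis by (simp only: inverse_divide) (simp add: divide_inverse mult.commute)
    qed
    have par: "odd (x + y + (p + q + int k)) \<longleftrightarrow> \<not> odd (x + y + ?s)" by presburger
    show "inverse (- 1 * gauge ?s ?ia v) = ?g v * ?h v"
    proof (cases "odd (x + y + ?s)")
      case True
      show ?thesis unfolding xy gauge_def cell_a_def cell_b_def prod.case par if_P[OF True]
        using inv[OF slice_nz slice_nz] True by simp
    next
      case False
      show ?thesis unfolding xy gauge_def cell_a_def cell_b_def prod.case par if_not_P[OF False]
        using inv[OF slice_nz slice_nz] False by (simp add: mult.commute)
    qed
  qed
  also have "\<dots> = (\<Prod>v\<in>aztec_vertices k ?c. ?g v) * (\<Prod>v\<in>aztec_vertices k ?c. ?h v)" by (rule prod.distrib)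
  finally have iZ: "dimer_Z (Suc k) ?c ?ia \<phi> = (\<Prod>C\<in>?I. ?\<sigma> C) * (\<Prod>C\<in>?I. ?r C)
      * ((\<Prod>v\<in>aztec_vertices k ?c. ?g v) * (\<Prod>v\<in>aztec_vertices k ?c. ?h v))
      * dimer_Z k ?c ?ia' (flip_horizontal \<phi>)" .
  have IH: "X (n + Suc k + 1) ?c * dimer_Z k ?c ?a' (flip_horizontal \<phi>)
      = (\<Prod>d\<in>aztec_faces k ?c. ?a' d) * dimer_Z k ?c ?ia' (flip_horizontal \<phi>)"
    using Suc.IH[of "Suc n" "flip_horizontal \<phi>"] Suc.prems square_orientation_flip by simp
  \<comment> \<open>The prefactors of the two dimer sums differ by a monomial, which turns the face
    product of the larger diamond into that of the smaller one with the updated labels.\<close>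
  have F: "(\<Prod>d\<in>aztec_faces (Suc k) ?c. ?a d) * ((\<Prod>C\<in>?I. ?r C) * (\<Prod>v\<in>aztec_vertices k ?c. ?h v))
      = (\<Prod>d\<in>aztec_faces k ?c. ?a' d)"
  proof -
    let ?A = "\<Prod>C\<in>?I. ?a C" and ?A' = "\<Prod>C\<in>?I. ?a' C"
    let ?B = "\<Prod>(x, y)\<in>?I. ?a (x, y + 1) * ?a (x + 1, y) * ?a (x, y - 1) * ?a (x - 1, y)"
    let ?L = "\<Prod>d\<in>aztec_cells (Suc (Suc k)) ?c. ?a d" and ?L' = "\<Prod>d\<in>aztec_cells k ?c. ?a d"
    have f1: "(\<Prod>d\<in>aztec_faces (Suc k) ?c. ?a d) = ?L * ?A"
      unfolding aztec_faces_eq[of "Suc k"]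
      by (rule prod.union_disjoint) (simp_all add: finite_aztec_cells aztec_cells_disjoint)
    have f2: "(\<Prod>d\<in>aztec_faces k ?c. ?a' d) = ?A' * (\<Prod>d\<in>aztec_cells k ?c. ?a' d)"
      unfolding aztec_faces_eq[of k]
      by (rule prod.union_disjoint) (simp_all add: finite_aztec_cells aztec_cells_disjoint)
    have f3: "(\<Prod>d\<in>aztec_cells k ?c. ?a' d) = ?L'"
    proof (rule prod.cong[OF refl])
      fix d assume d: "d \<in> aztec_cells k ?c"
      obtain x y where xy: "d = (x, y)" by fastforce
      have "odd (x + y + (p + q + int k))" using d unfolding xy mem_aztec_cells by blast
      then have "even (x + y + ?s)" by presburger
      then show "?a' d = ?a d" unfolding xy by (rule same)
    qed
    have f4: "(\<Prod>C\<in>?I. ?r C) = ?A' / (?A * ?B)"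
      unfolding prod_dividef[symmetric] prod.distrib[symmetric] by (rule prod.cong) auto
    have f5: "?L * (\<Prod>v\<in>aztec_vertices k ?c. ?h v) = ?B * ?L'"
      by (rule aztec_weight_count)
    have nz: "?A \<noteq> 0" "?B \<noteq> 0"
      using slice_nz by (auto simp: finite_aztec_cells)
    have cancel: "L * A * (A' / (A * B) * H) = A' * L'" if "A \<noteq> 0" "B \<noteq> 0" "L * H = B * L'" for L A A' B H L' :: real
    proof -
      have "L * A * (A' / (A * B) * H) = A' * (L * H) / B" using that(1) by simp
      then show ?thesis unfolding that(3) using that(2) by simp
    qed
    show ?thesis unfolding f1 f2 f3 f4 by (rule cancel[OF nz f5])
  qed
  let ?\<Sigma> = "\<Prod>C\<in>?I. ?\<sigma> C" and ?G = "\<Prod>v\<in>aztec_vertices k ?c. ?g v"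
  have "X (n + Suc k + 1) ?c * dimer_Z (Suc k) ?c ?a \<phi>
      = ?\<Sigma> * ?G * (X (n + Suc k + 1) ?c * dimer_Z k ?c ?a' (flip_horizontal \<phi>))"
    unfolding Z by (simp only: mult.assoc mult.commute mult.left_commute)
  also have "\<dots> = (\<Prod>d\<in>aztec_faces (Suc k) ?c. ?a d) * dimer_Z (Suc k) ?c ?ia \<phi>"
    unfolding IH iZ F[symmetric] by (simp only: mult.assoc mult.commute mult.left_commute)
  finally show ?case .
qed

lemma kasteleyn_square_orientation:
  assumes K: "kasteleyn_orientation k c \<phi>"
  shows "square_orientation k c \<phi>"
proof -
  have pm: "\<phi> (u, v) \<in> {-1, 1} \<and> \<phi> (v, u) = - \<phi> (u, v)" if "(u, v) \<in> edges_in (aztec_vertices k c)" for u v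
    using K that unfolding kasteleyn_orientation_def aztec_dedges_eq by blast
  have "\<phi> ((x, y), (x - 1, y)) * \<phi> ((x - 1, y - 1), (x, y - 1))
        * (\<phi> ((x, y), (x, y - 1)) * \<phi> ((x - 1, y - 1), (x - 1, y))) = -1"
    if C: "(x, y) \<in> internal_faces k c" for x y
  proof -
    note E = face_edges_in[OF C]
    have P: "(\<Prod>e \<in> {(w, b) \<in> face_dedges (x, y). white w}. \<phi> e) = -1"
      using K C unfolding kasteleyn_orientation_def by blast
    show ?thesis
    proof (cases "even (x + y)")
      case True
      have "{(w, b) \<in> face_dedges (x, y). white w} = {((x, y), (x - 1, y)), ((x - 1, y - 1), (x, y - 1)),
          ((x, y), (x, y - 1)), ((x - 1, y - 1), (x - 1, y))}"
        using True by (auto simp: face_dedges_def face_vertices_def adjacent_def white_def)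
      then show ?thesis using P by (simp add: mult.assoc)
    next
      case False
      \<comment> \<open>In this parity the white corners are the other two; all four edges are
        reversed, and the four sign changes cancel.\<close>
      have "{(w, b) \<in> face_dedges (x, y). white w} = {((x - 1, y), (x, y)), ((x, y - 1), (x - 1, y - 1)),
          ((x, y - 1), (x, y)), ((x - 1, y), (x - 1, y - 1))}"
        using False by (auto simp: face_dedges_def face_vertices_def adjacent_def white_def)
      then show ?thesis using P pm[OF E(1)] pm[OF E(2)] pm[OF E(3)] pm[OF E(4)] by (simp add: mult.assoc)
    qed
  qed
  then show ?thesis unfolding square_orientation_def using pm by blast
qed

section \<open>Pentagram maps\<close>

unbundle cross3_syntax

text \<open>If both last coordinates are nonzero, this is \<open>x $ 2 * y $ 2\<close> times the
  difference of the \<open>l\<close>-th affine coordinates. As a polynomial it makes sense in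
  general.\<close>

definition bracket :: "3 \<Rightarrow> real ^ 3 \<Rightarrow> real ^ 3 \<Rightarrow> real" where
  "bracket l x y = x $ l * y $ 2 - x $ 2 * y $ l"

text \<open>Four vectors in a three-dimensional space: the relation among the projections of three of them
  lifts up to a multiple of the centre of projection.\<close>

lemma bracket_relation:
  assumes "l \<in> {0, 1}" "C \<bullet> (S \<times> W) = 0"
  shows "bracket l S W * (C \<bullet> X) + bracket l W C * (S \<bullet> X) + bracket l C S * (W \<bullet> X) = 0"
proof -
  \<comment> \<open>In the index type the numerals \<open>3\<close> and \<open>0\<close> denote the
    same element; \<open>sum_3\<close> and \<open>cross_components\<close> are stated with
    \<open>3\<close>.\<close>
  have "l = 3 \<or> l = 1" using assms(1) by auto
  then show ?thesis
  proof
    assume l: "l = 3"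
    have "bracket l S W * (C \<bullet> X) + bracket l W C * (S \<bullet> X) + bracket l C S * (W \<bullet> X) = - (C \<bullet> (S \<times> W)) * X $ 1"
      unfolding l bracket_def inner_vec_def sum_3 cross_components by (simp add: algebra_simps)
    then show ?thesis using assms(2) by simp
  next
    assume l: "l = 1"
    have "bracket l S W * (C \<bullet> X) + bracket l W C * (S \<bullet> X) + bracket l C S * (W \<bullet> X) = (C \<bullet> (S \<times> W)) * X $ 3"
      unfolding l bracket_def inner_vec_def sum_3 cross_components by (simp add: algebra_simps)
    then show ?thesis using assms(2) by simp
  qed
qed

text \<open>\<open>Q\<close> lies on the lines \<open>WN\<close> and \<open>SE\<close>, so it represents their intersection \<open>P\<close> unless it vanishes.
  The coefficients of \<open>Q\<close> are those of the dSKP equation.\<close>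

lemma menelaus:
  fixes C N E S W :: "real ^ 3"
  assumes l: "l \<in> {0, 1}" and C: "C \<bullet> (S \<times> W) = 0" "C \<bullet> (E \<times> N) = 0"
  defines "P \<equiv> (S \<times> E) \<times> (W \<times> N)"
    and "Q \<equiv> (bracket l E C * bracket l S W) *\<^sub>R N + (bracket l C S * bracket l E N) *\<^sub>R W"
  shows "Q $ l * P $ 2 = Q $ 2 * P $ l"
proof -
  have 1: "Q \<bullet> (W \<times> N) = 0"
    unfolding Q_def by (simp add: inner_add_left dot_cross_self)
  have a: "bracket l S W * (C \<bullet> (S \<times> E)) + bracket l C S * (W \<bullet> (S \<times> E)) = 0"
    using bracket_relation[OF l C(1), of "S \<times> E"] by (simp add: dot_cross_self)
  have b: "bracket l E N * (C \<bullet> (S \<times> E)) + bracket l C E * (N \<bullet> (S \<times> E)) = 0"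
    using bracket_relation[OF l C(2), of "S \<times> E"] by (simp add: dot_cross_self)
  have "Q \<bullet> (S \<times> E) = bracket l S W * (bracket l E C * (N \<bullet> (S \<times> E))) + bracket l E N * (bracket l C S * (W \<bullet> (S \<times> E)))"
    unfolding Q_def by (simp add: inner_add_left)
  also have "bracket l E C * (N \<bullet> (S \<times> E)) = bracket l E N * (C \<bullet> (S \<times> E))"
    using b by (simp add: bracket_def algebra_simps)
  also have "bracket l C S * (W \<bullet> (S \<times> E)) = - (bracket l S W * (C \<bullet> (S \<times> E)))"
    using a by simp
  finally have 2: "Q \<bullet> (S \<times> E) = 0" by simp
  have "Q \<times> P = 0" unfolding P_def Lagrange[of Q "S \<times> E" "W \<times> N"] using 1 2 by simp
  \<comment> \<open>Up to sign, the bracket of \<open>Q\<close> and \<open>P\<close> is a component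
    of their cross product: the first for \<open>l = 3\<close>, the third for
    \<open>l = 1\<close>.\<close>
  then have "(Q \<times> P) $ 1 = 0" "(Q \<times> P) $ 3 = 0" by simp_all
  moreover have "l = 3 \<or> l = 1" using l by auto
  ultimately show ?thesis unfolding cross_components by auto
qed

text \<open>The cross product of two points represents the line through them, and that of two lines
  their meet. Nothing is normalised, so the coordinates are polynomials in those of
  \<open>V\<close>. Level 0 is meant for even \<open>m\<close>.\<close>

fun pentagram_lift :: "(int \<Rightarrow> real ^ 3) \<Rightarrow> nat \<Rightarrow> int \<Rightarrow> real ^ 3" where
  "pentagram_lift V 0 m = V (m div 2)"
| "pentagram_lift V (Suc n) m = (pentagram_lift V n (m - 3) \<times> pentagram_lift V n (m + 1))
     \<times> (pentagram_lift V n (m - 1) \<times> pentagram_lift V n (m + 3))"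

text \<open>Among the neighbours of a face, north and east or south and west differ by the shift 2,
  north and west or south and east by the shift 4. The shift -3 leads from a face to its southern
  neighbour; separating these two keeps the dSKP denominator from vanishing.\<close>

definition generic_lift :: "3 \<Rightarrow> (nat \<Rightarrow> int \<Rightarrow> real ^ 3) \<Rightarrow> bool" where
  "generic_lift l F \<longleftrightarrow> (\<forall>n m. even (m + int n) \<longrightarrow> F n m $ l \<noteq> 0 \<and> F n m $ 2 \<noteq> 0 \<and>
     bracket l (F n m) (F n (m + 2)) \<noteq> 0 \<and> bracket l (F n m) (F n (m + 4)) \<noteq> 0 \<and>
     bracket l (F n m) (F (Suc n) (m - 3)) \<noteq> 0)"

text \<open>If the vectors are read as lines, \<open>p \<times> r\<close> and
  \<open>r \<times> q\<close> are two points of \<open>r\<close>, so the line joining them is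
  \<open>r\<close> again.\<close>

lemma cross_common_line: "(p \<times> r) \<times> (r \<times> q) = ((p \<times> r) \<bullet> q) *\<^sub>R (r :: real ^ 3)"
  unfolding Lagrange by (simp add: dot_cross_self)

text \<open>The complete quadrilateral: \<open>S\<close>, \<open>W\<close>, \<open>C\<close> are collinear, and so are \<open>E\<close>, \<open>N\<close>, \<open>C\<close>.\<close>

lemma generic_lift_dskp:
  fixes V :: "int \<Rightarrow> real ^ 3"
  defines "F \<equiv> pentagram_lift V"
  assumes g: "generic_lift l F" and l: "l \<in> {0, 1}" and m: "even (m + int n)"
  defines "x \<equiv> \<lambda>n m. F n m $ l / F n m $ 2"
  shows "dskp (x n m) (x (Suc n) (m + 3)) (x (Suc n) (m + 1)) (x (Suc n) (m - 3)) (x (Suc n) (m - 1))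
    (x (Suc (Suc n)) m)"
proof -
  let ?C = "F n m" and ?N = "F (Suc n) (m + 3)" and ?E = "F (Suc n) (m + 1)" and ?S = "F (Suc n) (m - 3)"
    and ?W = "F (Suc n) (m - 1)" and ?P = "F (Suc (Suc n)) m"
  let ?r = "F n (m - 4) \<times> F n m" and ?r' = "F n m \<times> F n (m + 4)"
  have S: "?S = (F n (m - 6) \<times> F n (m - 2)) \<times> ?r" and W: "?W = ?r \<times> (F n (m - 2) \<times> F n (m + 2))"
    and E: "?E = (F n (m - 2) \<times> F n (m + 2)) \<times> ?r'" and N: "?N = ?r' \<times> (F n (m + 2) \<times> F n (m + 6))"
    and P: "?P = (?S \<times> ?E) \<times> (?W \<times> ?N)"
    by (simp_all add: F_def add.commute[of m])
  have C: "?C \<bullet> (?S \<times> ?W) = 0" "?C \<bullet> (?E \<times> ?N) = 0"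
    unfolding S W E N cross_common_line by (simp_all add: dot_cross_self)
  have even: "even (m + 3 + int (Suc n))" "even (m + 1 + int (Suc n))" "even (m - 3 + int (Suc n))"
    "even (m - 1 + int (Suc n))" "even (m + int (Suc (Suc n)))"
    using m by presburger+
  have G: "F n' m' $ 2 \<noteq> 0" "bracket l (F n' m') (F n' (m' + 2)) \<noteq> 0" "bracket l (F n' m') (F n' (m' + 4)) \<noteq> 0"
     "bracket l (F n' m') (F (Suc n') (m' - 3)) \<noteq> 0" if "even (m' + int n')" for n' m'
    using g that unfolding generic_lift_def by blast+
  have z: "?C $ 2 \<noteq> 0" "?N $ 2 \<noteq> 0" "?E $ 2 \<noteq> 0" "?S $ 2 \<noteq> 0" "?W $ 2 \<noteq> 0" "?P $ 2 \<noteq> 0"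
    using G(1)[OF m] G(1)[OF even(1)] G(1)[OF even(2)] G(1)[OF even(3)] G(1)[OF even(4)] G(1)[OF even(5)] by auto
  have br: "bracket l A B = A $ 2 * B $ 2 * (A $ l / A $ 2 - B $ l / B $ 2)" if "A $ 2 \<noteq> 0" "B $ 2 \<noteq> 0" for A B
    using that by (simp add: bracket_def field_simps)
  have ne: "x (Suc n) (m + 3) \<noteq> x (Suc n) (m + 1)" "x (Suc n) (m + 3) \<noteq> x (Suc n) (m - 1)"
    "x (Suc n) (m - 3) \<noteq> x (Suc n) (m + 1)" "x (Suc n) (m - 3) \<noteq> x (Suc n) (m - 1)" "x n m \<noteq> x (Suc n) (m - 3)"
    using G(2)[OF even(2)] G(3)[OF even(4)] G(3)[OF even(3)] G(2)[OF even(3)] G(4)[OF m] z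
    by (simp_all add: br x_def ac_simps)
  define c where "c = x n m"
  define nn where "nn = x (Suc n) (m + 3)"
  define e where "e = x (Suc n) (m + 1)"
  define s where "s = x (Suc n) (m - 3)"
  define w where "w = x (Suc n) (m - 1)"
  define c' where "c' = x (Suc (Suc n)) m"
  let ?Q = "(bracket l ?E ?C * bracket l ?S ?W) *\<^sub>R ?N + (bracket l ?C ?S * bracket l ?E ?N) *\<^sub>R ?W"
  define K where "K = ?E $ 2 * ?C $ 2 * ?S $ 2 * ?W $ 2 * ?N $ 2"
  have xl: "?N $ l = ?N $ 2 * nn" "?W $ l = ?W $ 2 * w" "?P $ l = ?P $ 2 * c'"
    using z by (simp_all add: nn_def w_def c'_def x_def)
  have bs: "bracket l ?E ?C = ?E $ 2 * ?C $ 2 * (e - c)" "bracket l ?S ?W = ?S $ 2 * ?W $ 2 * (s - w)"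
    "bracket l ?C ?S = ?C $ 2 * ?S $ 2 * (c - s)" "bracket l ?E ?N = ?E $ 2 * ?N $ 2 * (e - nn)"
    using z by (simp_all add: br c_def nn_def e_def s_def w_def x_def)
  have Ql: "?Q $ l = K * ((e - c) * (s - w) * nn + (c - s) * (e - nn) * w)"
    by (simp add: bs xl K_def) algebra
  have Q2: "?Q $ 2 = K * dskp_delta c nn e s w"
    by (simp add: bs K_def dskp_delta_def) algebra
  have "?Q $ l * ?P $ 2 = ?Q $ 2 * ?P $ l"
    unfolding P by (rule menelaus[OF l C])
  then have "K * ?P $ 2 * ((e - c) * (s - w) * nn + (c - s) * (e - nn) * w) = K * ?P $ 2 * (c' * dskp_delta c nn e s w)"
    unfolding Ql Q2 xl by algebra
  moreover have "K * ?P $ 2 \<noteq> 0" using z by (simp add: K_def)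
  ultimately have eq: "c' * dskp_delta c nn e s w = (e - c) * (s - w) * nn + (c - s) * (e - nn) * w"
    using mult_left_cancel by metis
  have "dskp_delta c nn e s w \<noteq> 0"
  proof
    assume d: "dskp_delta c nn e s w = 0"
    then have "(e - c) * (s - w) * nn + (c - s) * (e - nn) * w = 0" using eq by simp
    \<comment> \<open>The numerator minus \<open>nn\<close> times the denominator factors, as in the
      first equation of \<open>dskp_diff\<close>; none of the factors is zero.\<close>
    then have "(c - s) * (e - nn) * (w - nn) = 0" using d unfolding dskp_delta_def by algebra
    then show False using ne by (simp add: c_def nn_def e_def s_def w_def)
  qed
  then show ?thesis using eq ne unfolding dskp_def c_def nn_def e_def s_def w_def c'_def by blast
qed

text \<open>The pentagram map sends the polygon inscribed at equally spaced abscissas in a parabola to one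
  inscribed in a vertical translate. Its \<open>l\<close>-th coordinates are therefore explicit and pairwise
  distinct at each level; the offset \<open>1/4\<close> below keeps them away from \<open>0\<close>.\<close>

definition parabola_point :: "3 \<Rightarrow> real \<Rightarrow> real \<Rightarrow> real ^ 3" where
  "parabola_point l x b = (\<chi> i. if i = 2 then 1 else if i = l then x else x\<^sup>2 + b)"

lemma parabola_point_nth:
  "l \<in> {0, 1} \<Longrightarrow> parabola_point l x b $ l = x" "parabola_point l x b $ 2 = 1"
  by (auto simp: parabola_point_def)

text \<open>The chord over the abscissas s and t is the line y = (s + t) X - s t + b. The two chords
  here have slopes 2 x - 1 and 2 x + 1, and both have height x^2 + b + 3/4 at X = x.\<close>

lemma parabola_cross:
  assumes "l \<in> {0, 1}"
  shows "\<exists>\<kappa>\<noteq>0. (parabola_point l (x - 3/2) b \<times> parabola_point l (x + 1/2) b)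
      \<times> (parabola_point l (x - 1/2) b \<times> parabola_point l (x + 3/2) b) = \<kappa> *\<^sub>R parabola_point l x (b + 3/4)"
proof -
  have "l = 3 \<or> l = 1" using assms by auto
  then show ?thesis
  proof
    assume l: "l = 3"
    \<comment> \<open>The factor 8 is the product of the two abscissa differences and the slope
      difference, each equal to 2. For \<open>l = 1\<close> two coordinates are exchanged, and each
      of the three cross products changes its sign.\<close>
    show ?thesis
      by (rule exI[of _ 8])
        (simp add: l vec_eq_iff forall_3 cross_components parabola_point_def power2_eq_square field_simps)
  next
    assume l: "l = 1"
    show ?thesis
      by (rule exI[of _ "-8"])
        (simp add: l vec_eq_iff forall_3 cross_components parabola_point_def power2_eq_square field_simps)
  qed
qed

lemma pentagram_lift_parabola:
  assumes l: "l \<in> {0, 1}" and V: "\<And>i. V i = parabola_point l (real_of_int i + 1/4) 0" and m: "even (m + int n)"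
  shows "\<exists>\<kappa>\<noteq>0. pentagram_lift V n m = \<kappa> *\<^sub>R parabola_point l (real_of_int m / 2 + 1/4) (3 / 4 * real n)"
  using m
proof (induction n arbitrary: m)
  case 0
  then obtain i where "m = 2 * i" by auto
  then show ?case by (intro exI[of _ 1]) (simp add: V)
next
  case (Suc n)
  let ?q = "\<lambda>j. parabola_point l (real_of_int m / 2 + 1/4 + j) (3 / 4 * real n)"
  have IH: "\<exists>\<kappa>\<noteq>0. pentagram_lift V n (m + j) = \<kappa> *\<^sub>R ?q (real_of_int j / 2)" if "odd j" for j
    using Suc.IH[of "m + j"] Suc.prems that by (simp add: add_divide_distrib ac_simps)
  obtain k1 k2 k3 k4 where k: "k1 \<noteq> 0" "k2 \<noteq> 0" "k3 \<noteq> 0" "k4 \<noteq> 0"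
    and q: "pentagram_lift V n (m - 3) = k1 *\<^sub>R ?q (- 3/2)" "pentagram_lift V n (m + 1) = k2 *\<^sub>R ?q (1/2)"
      "pentagram_lift V n (m - 1) = k3 *\<^sub>R ?q (- 1/2)" "pentagram_lift V n (m + 3) = k4 *\<^sub>R ?q (3/2)"
    using IH[of "-3"] IH[of 1] IH[of "-1"] IH[of 3] by auto
  obtain \<kappa> where \<kappa>: "\<kappa> \<noteq> 0" "(?q (- 3/2) \<times> ?q (1/2)) \<times> (?q (- 1/2) \<times> ?q (3/2))
      = \<kappa> *\<^sub>R parabola_point l (real_of_int m / 2 + 1/4) (3 / 4 * real n + 3 / 4)"
    using parabola_cross[OF l, of "real_of_int m / 2 + 1/4" "3 / 4 * real n"] by auto
  have "pentagram_lift V (Suc n) m = (k1 * k2 * k3 * k4) *\<^sub>R ((?q (- 3/2) \<times> ?q (1/2)) \<times> (?q (- 1/2) \<times> ?q (3/2)))"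
    by (simp add: q cross_mult_left cross_mult_right mult.assoc mult.commute mult.left_commute)
  also have "\<dots> = (k1 * k2 * k3 * k4 * \<kappa>) *\<^sub>R parabola_point l (real_of_int m / 2 + 1/4) (3 / 4 * real (Suc n))"
    unfolding \<kappa>(2) by (simp add: distrib_left add.commute)
  finally show ?case using k \<kappa>(1) by (intro exI[of _ "k1 * k2 * k3 * k4 * \<kappa>"]) simp
qed

section \<open>Points and lines of the projective plane in homogeneous coordinates\<close>

lemma rep_rp2_nonzero: "rep_rp2 P \<noteq> 0"
  using Quotient3_rep_reflp[OF Quotient3_rp2, of P] by (simp add: proportional_def)

lemma rp2_eqI:
  assumes "rep_rp2 Q = c *\<^sub>R rep_rp2 P"
  shows "P = Q"
  using assms Quotient3_rel_rep[OF Quotient3_rp2, of P Q] rep_rp2_nonzero by (auto simp: proportional_def)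

lemma rep_abs_rp2:
  assumes "x \<noteq> 0"
  shows "\<exists>c\<noteq>0. rep_rp2 (abs_rp2 x) = c *\<^sub>R x"
proof -
  have "proportional x x" using assms by (auto simp: proportional_def intro: exI[of _ 1])
  then have "proportional (rep_rp2 (abs_rp2 x)) x" by (rule Quotient3_rep_abs[OF Quotient3_rp2])
  then obtain c where c: "x = c *\<^sub>R rep_rp2 (abs_rp2 x)" by (auto simp: proportional_def)
  then have "c \<noteq> 0" using assms by auto
  then show ?thesis using c by (intro exI[of _ "inverse c"]) (metis inverse_nonzero_iff_nonzero scaleR_scaleR left_inverse scaleR_one)
qed

lemma affine_coord_rep:
  "affine_coord l P = (if rep_rp2 P $ 2 = 0 then None else Some (rep_rp2 P $ l / rep_rp2 P $ 2))"
  using affine_coord.abs_eq[OF Quotient3_rep_reflp[OF Quotient3_rp2, of P], of l]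
  by (simp add: Quotient3_abs_rep[OF Quotient3_rp2])

lemma has_affine_coord_rep: "has_affine_coord l P \<longleftrightarrow> \<not> (rep_rp2 P $ l = 0 \<and> rep_rp2 P $ 2 = 0)"
  using has_affine_coord.abs_eq[OF Quotient3_rep_reflp[OF Quotient3_rp2, of P], of l]
  by (simp add: Quotient3_abs_rep[OF Quotient3_rp2])

lemma cross_eq_0_multiple:
  fixes x y :: "real ^ 3"
  assumes "x \<times> y = 0" "x \<noteq> 0"
  shows "\<exists>c. y = c *\<^sub>R x"
proof -
  have "(x \<bullet> y) *\<^sub>R x - (x \<bullet> x) *\<^sub>R y = 0" using Lagrange[of x x y] assms(1) by simp
  then have "(x \<bullet> x) *\<^sub>R y = (x \<bullet> y) *\<^sub>R x" by simp
  then have "y = ((x \<bullet> y) / (x \<bullet> x)) *\<^sub>R x"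
    using assms(2) by (metis inner_eq_zero_iff divide_inverse_commute scaleR_scaleR left_inverse scaleR_one)
  then show ?thesis by blast
qed

lemma cross_rep_rp2_nonzero: "P \<noteq> Q \<Longrightarrow> rep_rp2 P \<times> rep_rp2 Q \<noteq> 0"
  using cross_eq_0_multiple rep_rp2_nonzero rp2_eqI by metis

text \<open>If \<open>x\<close> is orthogonal to the normal \<open>n\<close> of the line, then
  \<open>n \<times> (x \<times> n)\<close> is a nonzero multiple of \<open>x\<close>, and Lagrange's
  identity writes it in terms of the two spanning vectors.\<close>

lemma mem_line_through:
  assumes "P \<noteq> Q"
  shows "R \<in> line_through P Q \<longleftrightarrow> rep_rp2 R \<bullet> (rep_rp2 P \<times> rep_rp2 Q) = 0"
proof
  assume "R \<in> line_through P Q"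
  then obtain s t where "rep_rp2 R = s *\<^sub>R rep_rp2 P + t *\<^sub>R rep_rp2 Q"
    by (auto simp: line_through_def span_insert span_singleton) (metis add.commute diff_add_cancel)
  then show "rep_rp2 R \<bullet> (rep_rp2 P \<times> rep_rp2 Q) = 0" by (simp add: inner_add_left dot_cross_self)
next
  let ?a = "rep_rp2 P" and ?b = "rep_rp2 Q" and ?x = "rep_rp2 R"
  let ?n = "?a \<times> ?b"
  let ?S = "span {?a, ?b}"
  assume *: "?x \<bullet> ?n = 0"
  have ab: "?a \<in> ?S" "?b \<in> ?S" by (auto intro: span_base)
  have "?n \<times> ?a \<in> ?S" "?n \<times> ?b \<in> ?S"
    using cross_skew[of ?n ?a] cross_skew[of ?n ?b] Lagrange[of ?a ?a ?b] Lagrange[of ?b ?a ?b] ab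
    by (simp_all add: span_neg span_diff span_scale)
  moreover have "?x \<times> ?n = (?x \<bullet> ?b) *\<^sub>R ?a - (?x \<bullet> ?a) *\<^sub>R ?b" by (rule Lagrange)
  ultimately have "?n \<times> (?x \<times> ?n) \<in> ?S"
    by (simp add: Cross3.right_diff_distrib cross_mult_right span_diff span_scale)
  moreover have "?n \<times> (?x \<times> ?n) = (?n \<bullet> ?n) *\<^sub>R ?x"
    unfolding Lagrange[of ?n ?x ?n] using * by (simp add: inner_commute)
  ultimately have "(?n \<bullet> ?n) *\<^sub>R ?x \<in> ?S" by simp
  then have "inverse (?n \<bullet> ?n) *\<^sub>R ((?n \<bullet> ?n) *\<^sub>R ?x) \<in> ?S" by (rule span_scale)
  then have "?x \<in> ?S" using cross_rep_rp2_nonzero[OF assms] by simp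
  then show "R \<in> line_through P Q" by (simp add: line_through_def)
qed

text \<open>If the cross product of the two lines vanished, the lines would coincide, and both
  \<open>A\<close> and \<open>B\<close> would lie in the singleton.\<close>

lemma lines_meet:
  assumes "A \<noteq> B" "C \<noteq> D" and L: "line_through A B \<inter> line_through C D = {P}"
  defines "X \<equiv> (rep_rp2 A \<times> rep_rp2 B) \<times> (rep_rp2 C \<times> rep_rp2 D)"
  shows "X \<noteq> 0" "\<exists>c\<noteq>0. rep_rp2 P = c *\<^sub>R X"
proof -
  let ?u = "rep_rp2 A \<times> rep_rp2 B" and ?v = "rep_rp2 C \<times> rep_rp2 D"
  show X: "X \<noteq> 0"
  proof
    assume "X = 0"
    then obtain c where c: "?v = c *\<^sub>R ?u"
      using cross_eq_0_multiple[of ?u ?v] cross_rep_rp2_nonzero[OF assms(1)] unfolding X_def by blast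
    have "A \<in> line_through A B" "B \<in> line_through A B" "A \<in> line_through C D" "B \<in> line_through C D"
      unfolding mem_line_through[OF assms(1)] mem_line_through[OF assms(2)] c by (simp_all add: dot_cross_self)
    then have "A \<in> {P}" "B \<in> {P}" unfolding L[symmetric] by simp_all
    then show False using assms(1) by simp
  qed
  obtain c where c: "c \<noteq> 0" "rep_rp2 (abs_rp2 X) = c *\<^sub>R X" using rep_abs_rp2[OF X] by blast
  have "abs_rp2 X \<in> line_through A B" "abs_rp2 X \<in> line_through C D"
    unfolding mem_line_through[OF assms(1)] mem_line_through[OF assms(2)] c(2)
    by (simp_all add: X_def dot_cross_self inner_commute)
  then have "abs_rp2 X = P" using L by blast
  then show "\<exists>c\<noteq>0. rep_rp2 P = c *\<^sub>R X" using c by blast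
qed

lemma pentagram_lift_tilde:
  assumes f: "pentagram_lattice_map f" and V: "\<And>i. V i = rep_rp2 (tilde f (2 * i) 0)"
    and "even (m + int n)"
  shows "\<exists>c\<noteq>0. rep_rp2 (tilde f m (int n)) = c *\<^sub>R pentagram_lift V n m"
  using assms(3)
proof (induction n arbitrary: m)
  case 0
  then have "2 * (m div 2) = m" by simp
  then show ?case by (intro exI[of _ 1]) (simp add: V)
next
  case (Suc n)
  let ?A = "tilde f (m - 3) (int n)" and ?B = "tilde f (m + 1) (int n)"
    and ?C = "tilde f (m - 1) (int n)" and ?D = "tilde f (m + 3) (int n)"
  have par: "even (m - 3 + int n)" "even (m + 1 + int n)" "even (m - 1 + int n)" "even (m + 3 + int n)"
    using Suc.prems by presburger+
  have "int (Suc n) - 1 = int n" by simp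
  then have "?A \<noteq> ?B" "?C \<noteq> ?D" "line_through ?A ?B \<inter> line_through ?C ?D = {tilde f m (int (Suc n))}"
    using f[unfolded pentagram_lattice_map_def, rule_format, OF Suc.prems] by simp_all
  from lines_meet(2)[OF this] obtain c where c: "c \<noteq> 0"
    "rep_rp2 (tilde f m (int (Suc n))) = c *\<^sub>R ((rep_rp2 ?A \<times> rep_rp2 ?B) \<times> (rep_rp2 ?C \<times> rep_rp2 ?D))"
    by blast
  obtain k1 k2 k3 k4 where k: "k1 \<noteq> 0" "k2 \<noteq> 0" "k3 \<noteq> 0" "k4 \<noteq> 0"
    "rep_rp2 ?A = k1 *\<^sub>R pentagram_lift V n (m - 3)" "rep_rp2 ?B = k2 *\<^sub>R pentagram_lift V n (m + 1)"
    "rep_rp2 ?C = k3 *\<^sub>R pentagram_lift V n (m - 1)" "rep_rp2 ?D = k4 *\<^sub>R pentagram_lift V n (m + 3)"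
    using Suc.IH[OF par(1)] Suc.IH[OF par(2)] Suc.IH[OF par(3)] Suc.IH[OF par(4)] by blast
  have "rep_rp2 (tilde f m (int (Suc n))) = (c * k1 * k2 * k3 * k4) *\<^sub>R pentagram_lift V (Suc n) m"
    unfolding c(2) k(5-8) by (simp add: cross_mult_left cross_mult_right mult.assoc mult.commute mult.left_commute)
  then show ?case using c(1) k(1-4) by (intro exI[of _ "c * k1 * k2 * k3 * k4"]) simp
qed

section \<open>Deformation to a generic polygon\<close>

definition poly_fun :: "(real \<Rightarrow> real) \<Rightarrow> bool" where
  "poly_fun h \<longleftrightarrow> (\<exists>p. h = poly p)"

lemma poly_fun_const: "poly_fun (\<lambda>t. c)"
  unfolding poly_fun_def by (rule exI[of _ "[:c:]"]) auto

lemma poly_fun_ident: "poly_fun (\<lambda>t. t)"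
  unfolding poly_fun_def by (rule exI[of _ "[:0, 1:]"]) auto

lemma poly_fun_add: "poly_fun g \<Longrightarrow> poly_fun h \<Longrightarrow> poly_fun (\<lambda>t. g t + h t)"
proof -
  assume "poly_fun g" "poly_fun h"
  then obtain p q where "g = poly p" "h = poly q" by (auto simp: poly_fun_def)
  then show ?thesis unfolding poly_fun_def by (intro exI[of _ "p + q"]) auto
qed

lemma poly_fun_diff: "poly_fun g \<Longrightarrow> poly_fun h \<Longrightarrow> poly_fun (\<lambda>t. g t - h t)"
proof -
  assume "poly_fun g" "poly_fun h"
  then obtain p q where "g = poly p" "h = poly q" by (auto simp: poly_fun_def)
  then show ?thesis unfolding poly_fun_def by (intro exI[of _ "p - q"]) auto
qed

lemma poly_fun_mult: "poly_fun g \<Longrightarrow> poly_fun h \<Longrightarrow> poly_fun (\<lambda>t. g t * h t)"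
proof -
  assume "poly_fun g" "poly_fun h"
  then obtain p q where "g = poly p" "h = poly q" by (auto simp: poly_fun_def)
  then show ?thesis unfolding poly_fun_def by (intro exI[of _ "p * q"]) auto
qed

lemmas poly_fun_intros = poly_fun_const poly_fun_ident poly_fun_add poly_fun_diff poly_fun_mult

lemma isCont_poly_fun: "poly_fun h \<Longrightarrow> isCont h a"
  unfolding poly_fun_def by auto

lemma countable_zeros_poly_fun:
  assumes "poly_fun h" "h c \<noteq> 0"
  shows "countable {t. h t = 0}"
proof -
  obtain p where p: "h = poly p" using assms(1) by (auto simp: poly_fun_def)
  then have "p \<noteq> 0" using assms(2) by auto
  then show ?thesis unfolding p by (intro countable_finite poly_roots_finite)
qed

text \<open>Genericity consists of infinitely many conditions, so the exceptional set is only known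
  to be countable. This suffices: a continuous function that is nonzero at \<open>a\<close> is
  nonzero on an interval, and no countable set contains one.\<close>

lemma isCont_zero_off_countable:
  fixes h :: "real \<Rightarrow> real"
  assumes h: "isCont h a" and B: "countable B" and zero: "\<And>t. t \<notin> B \<Longrightarrow> h t = 0"
  shows "h a = 0"
proof (rule ccontr)
  assume "h a \<noteq> 0"
  then obtain e where e: "e > 0" "\<And>y. dist a y < e \<Longrightarrow> h y \<noteq> 0"
    using continuous_at_avoid[of a h 0] h by auto
  have "{a<..<a + e} \<subseteq> B"
  proof
    fix t assume "t \<in> {a<..<a + e}"
    then have "dist a t < e" by (simp add: dist_real_def)
    then show "t \<in> B" using e(2) zero by blast
  qed
  then have "countable {a<..<a + e}" using B countable_subset by blast
  then show False using uncountable_open_interval[of a "a + e"] e(1) by simp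
qed

definition polygon_line :: "(int \<Rightarrow> real ^ 3) \<Rightarrow> (int \<Rightarrow> real ^ 3) \<Rightarrow> real \<Rightarrow> int \<Rightarrow> real ^ 3" where
  "polygon_line A W t i = (1 - t) *\<^sub>R A i + t *\<^sub>R W i"

lemma poly_fun_pentagram_lift: "poly_fun (\<lambda>t. pentagram_lift (polygon_line A W t) n m $ i)"
proof (induction n arbitrary: m i)
  case 0
  show ?case by (simp add: polygon_line_def poly_fun_intros)
next
  case (Suc n)
  have "i = 1 \<or> i = 2 \<or> i = 3" using exhaust_3 by blast
  then show ?case
    by (elim disjE) (simp_all add: cross_components poly_fun_intros Suc.IH)
qed

lemma poly_fun_bracket:
  "(\<And>i. poly_fun (\<lambda>t. x t $ i)) \<Longrightarrow> (\<And>i. poly_fun (\<lambda>t. y t $ i)) \<Longrightarrow> poly_fun (\<lambda>t. bracket l (x t) (y t))"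
  unfolding bracket_def by (intro poly_fun_intros)

lemma generic_lift_parabola:
  assumes l: "l \<in> {0, 1}" and V: "\<And>i. V i = parabola_point l (real_of_int i + 1/4) 0"
  shows "generic_lift l (pentagram_lift V)"
  unfolding generic_lift_def
proof (intro allI impI)
  fix n m assume m: "even (m + int n)"
  have P: "\<exists>\<kappa>\<noteq>0. pentagram_lift V n' m' $ l = \<kappa> * (real_of_int m' / 2 + 1/4) \<and> pentagram_lift V n' m' $ 2 = \<kappa>"
    if "even (m' + int n')" for n' m'
    using pentagram_lift_parabola[OF l V that] by (auto simp: parabola_point_nth(1)[OF l] parabola_point_nth(2))
  have par: "even (m + 2 + int n)" "even (m + 4 + int n)" "even (m - 3 + int (Suc n))" using m by presburger+
  have "4 * (real_of_int m / 2 + 1/4) = real_of_int (2 * m + 1)" by simp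
  moreover have "2 * m + 1 \<noteq> 0" by presburger
  ultimately have "real_of_int m / 2 + 1/4 \<noteq> 0" by (metis mult_zero_right of_int_eq_0_iff)
  moreover have "bracket l (pentagram_lift V n m) (pentagram_lift V n' m') \<noteq> 0"
    if m': "even (m' + int n')" "m' \<noteq> m" for n' m'
  proof -
    obtain k where k: "k \<noteq> 0" "pentagram_lift V n m $ l = k * (real_of_int m / 2 + 1/4)" "pentagram_lift V n m $ 2 = k"
      using P[OF m] by blast
    obtain k' where k': "k' \<noteq> 0" "pentagram_lift V n' m' $ l = k' * (real_of_int m' / 2 + 1/4)"
      "pentagram_lift V n' m' $ 2 = k'" using P[OF m'(1)] by blast
    have "bracket l (pentagram_lift V n m) (pentagram_lift V n' m') = k * k' * (real_of_int m - real_of_int m') / 2"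
      unfolding bracket_def k k' by (simp add: field_simps)
    moreover have "k * k' * (real_of_int m - real_of_int m') / 2 \<noteq> 0" using k(1) k'(1) m'(2) by simp
    ultimately show ?thesis by metis
  qed
  ultimately show "pentagram_lift V n m $ l \<noteq> 0 \<and> pentagram_lift V n m $ 2 \<noteq> 0 \<and>
      bracket l (pentagram_lift V n m) (pentagram_lift V n (m + 2)) \<noteq> 0 \<and>
      bracket l (pentagram_lift V n m) (pentagram_lift V n (m + 4)) \<noteq> 0 \<and>
      bracket l (pentagram_lift V n m) (pentagram_lift V (Suc n) (m - 3)) \<noteq> 0"
    using P[OF m] par by (auto simp del: pentagram_lift.simps)
qed

text \<open>Each of the countably many conditions is a polynomial in \<open>t\<close> that does not
  vanish at \<open>t = 1\<close>, where the polygon is \<open>W\<close>.\<close>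

lemma countable_not_generic:
  assumes l: "l \<in> {0, 1}" and W: "generic_lift l (pentagram_lift W)"
  shows "countable {t. \<not> generic_lift l (pentagram_lift (polygon_line A W t))}"
proof -
  let ?F = "\<lambda>t. pentagram_lift (polygon_line A W t)"
  have W1: "polygon_line A W 1 = W" by (simp add: polygon_line_def fun_eq_iff)
  let ?Z = "\<lambda>n m. {t. ?F t n m $ l = 0} \<union> {t. ?F t n m $ 2 = 0}
    \<union> {t. bracket l (?F t n m) (?F t n (m + 2)) = 0} \<union> {t. bracket l (?F t n m) (?F t n (m + 4)) = 0}
    \<union> {t. bracket l (?F t n m) (?F t (Suc n) (m - 3)) = 0}"
  have "countable (?Z n m)" if m: "even (m + int n)" for n m
    using W[unfolded generic_lift_def, rule_format, OF m]
    by (intro countable_Un countable_zeros_poly_fun[of _ 1] poly_fun_bracket poly_fun_pentagram_lift)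
      (simp_all only: W1 simp_thms not_False_eq_True)
  then have "countable (\<Union>(n, m) \<in> {(n, m). even (m + int n)}. ?Z n m)"
    by (intro countable_UN) auto
  moreover have "{t. \<not> generic_lift l (?F t)} \<subseteq> (\<Union>(n, m) \<in> {(n, m). even (m + int n)}. ?Z n m)"
    unfolding generic_lift_def by blast
  ultimately show ?thesis by (rule countable_subset[rotated])
qed

lemma isCont_dimer_Z:
  assumes "\<And>d. isCont (\<lambda>t. a t d) t0"
  shows "isCont (\<lambda>t. dimer_Z k c (a t) \<phi>) t0"
  unfolding dimer_Z_def by (intro continuous_intros assms)

text \<open>The denominator at level \<open>k + 1\<close> is cleared because it may vanish at the
  given polygon. The remaining divisions are by the initial denominators and, for the inverse
  labels, by the labels; these are nonzero by assumption, so both sides are continuous along the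
  deformation at \<open>t = 0\<close>.\<close>

lemma pentagram_dimer_ratio:
  fixes V :: "int \<Rightarrow> real ^ 3" and a :: "face \<Rightarrow> real"
  defines "F \<equiv> pentagram_lift V"
  assumes l: "l \<in> {0, 1}"
    and z: "\<And>m. even m \<Longrightarrow> F 0 m $ 2 \<noteq> 0" "\<And>m. odd m \<Longrightarrow> F 1 m $ 2 \<noteq> 0"
    and a: "\<And>x y. a (x, y) = (if even (x + y) then F 0 (x + 3 * y) $ l / F 0 (x + 3 * y) $ 2
        else F 1 (x + 3 * y) $ l / F 1 (x + 3 * y) $ 2)"
    and nz: "\<And>d. a d \<noteq> 0"
    and par: "even (p + q + int (k + 1))" and \<phi>: "square_orientation k (p, q) \<phi>"
  shows "F (k + 1) (p + 3 * q) $ l * dimer_Z k (p, q) a \<phi>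
    = F (k + 1) (p + 3 * q) $ 2
      * ((\<Prod>d\<in>aztec_faces k (p, q). a d) * dimer_Z k (p, q) (\<lambda>d. inverse (a d)) \<phi>)"
proof -
  define W where "W i = parabola_point l (real_of_int i + 1/4) 0" for i
  define G where "G t = pentagram_lift (polygon_line V W t)" for t
  \<comment> \<open>The index \<open>x + 3 * y\<close> turns the four neighbours of a face into the
    shifts 1, -1, 3, -3 of \<open>generic_lift_dskp\<close>; its parity is that of
    \<open>x + y\<close>.\<close>
  define X where "X t n = (\<lambda>(x, y). G t n (x + 3 * y) $ l / G t n (x + 3 * y) $ 2)" for t n
  define b where "b t = lattice_slice (X t) 0" for t
  define h where "h t = G t (k + 1) (p + 3 * q) $ l * dimer_Z k (p, q) (b t) \<phi>
    - G t (k + 1) (p + 3 * q) $ 2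
      * ((\<Prod>d\<in>aztec_faces k (p, q). b t d) * dimer_Z k (p, q) (\<lambda>d. inverse (b t d)) \<phi>)" for t
  have "polygon_line V W 0 = V" by (simp add: polygon_line_def fun_eq_iff)
  then have G0: "G 0 = F" by (simp add: G_def F_def)
  have b_eq: "b t (x, y) = (if even (x + y) then G t 0 (x + 3 * y) $ l / G t 0 (x + 3 * y) $ 2
        else G t 1 (x + 3 * y) $ l / G t 1 (x + 3 * y) $ 2)" for t x y
    by (cases "even (x + y)") (simp_all add: b_def lattice_slice_def X_def)
  have b0: "b 0 = a" using a by (auto simp: fun_eq_iff b_eq G0)
  have par3: "even (x + 3 * y + c) \<longleftrightarrow> even (x + y + c)" for x y c :: int by presburger
  have contG: "isCont (\<lambda>t. G t n m $ i) 0" for n m i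
    unfolding G_def by (rule isCont_poly_fun[OF poly_fun_pentagram_lift])
  have contb: "isCont (\<lambda>t. b t d) 0" for d
  proof -
    obtain x y where d: "d = (x, y)" by fastforce
    show ?thesis
    proof (cases "even (x + y)")
      case True
      then have "even (x + 3 * y)" by presburger
      then show ?thesis unfolding d b_eq if_P[OF True] using z(1) by (intro continuous_intros contG) (simp add: G0)
    next
      case False
      then have "odd (x + 3 * y)" by presburger
      then show ?thesis unfolding d b_eq if_not_P[OF False] using z(2) by (intro continuous_intros contG) (simp add: G0)
    qed
  qed
  have conti: "isCont (\<lambda>t. inverse (b t d)) 0" for d
    using nz by (intro continuous_intros contb) (simp add: b0)
  have "isCont h 0"
    unfolding h_def by (intro continuous_intros contG contb isCont_dimer_Z conti)
  moreover have "countable {t. \<not> generic_lift l (G t)}"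
    unfolding G_def by (rule countable_not_generic[OF l generic_lift_parabola[OF l W_def]])
  moreover have "h t = 0" if "t \<notin> {t. \<not> generic_lift l (G t)}" for t
  proof -
    have g: "generic_lift l (G t)" using that by simp
    have gz: "G t n m $ l \<noteq> 0" "G t n m $ 2 \<noteq> 0" if "even (m + int n)" for n m
      using g that unfolding generic_lift_def by blast+
    have "X t (0 + k + 1) (p, q) * dimer_Z k (p, q) (b t) \<phi>
      = (\<Prod>d\<in>aztec_faces k (p, q). b t d) * dimer_Z k (p, q) (\<lambda>d. inverse (b t d)) \<phi>"
      unfolding b_def
    proof (rule dskp_dimer_ratio[OF _ _ _ \<phi>])
      show "X t n (x, y) \<noteq> 0" if "even (x + y + int n)" for n x y
        using gz[of "x + 3 * y" n] that by (simp add: X_def par3 del: even_add)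
      show "dskp (X t n (x, y)) (X t (Suc n) (x, y + 1)) (X t (Suc n) (x + 1, y)) (X t (Suc n) (x, y - 1))
          (X t (Suc n) (x - 1, y)) (X t (Suc (Suc n)) (x, y))" if "even (x + y + int n)" for n x y
      proof -
        have m: "even (x + 3 * y + int n)" using that unfolding par3 .
        have s: "x + 3 * (y + 1) = x + 3 * y + 3" "x + 1 + 3 * y = x + 3 * y + 1"
          "x + 3 * (y - 1) = x + 3 * y - 3" "x - 1 + 3 * y = x + 3 * y - 1" by simp_all
        show ?thesis
          using generic_lift_dskp[OF g[unfolded G_def] l m] unfolding X_def prod.case s G_def .
      qed
      show "even (p + q + int (0 + k + 1))" using par by simp
    qed
    moreover have "G t (k + 1) (p + 3 * q) $ 2 \<noteq> 0"
      using gz(2)[of "p + 3 * q" "k + 1"] par unfolding par3 by blast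
    ultimately show ?thesis by (simp add: h_def X_def divide_eq_eq mult.commute)
  qed
  ultimately have "h 0 = 0" by (rule isCont_zero_off_countable)
  then show ?thesis by (simp add: h_def G0 b0)
qed

theorem theorem9p3:
  fixes f :: "int \<Rightarrow> int \<Rightarrow> rp2"
    and l :: 3
    and g gt :: "int \<Rightarrow> int \<Rightarrow> real option"
    and v :: "int \<Rightarrow> rp2"
    and u Tu :: "int \<Rightarrow> real option"
    and a :: "face \<Rightarrow> real"
  assumes "pentagram_lattice_map f"
    and "l \<in> {0, 1}"
    and "g = (\<lambda>i j. affine_coord l (f i j))"
    and "gt = (\<lambda>i j. affine_coord l (tilde f i j))"
    and "v = initial_polygon f"
    and "u = (\<lambda>i. affine_coord l (v i))"
    and "Tu = (\<lambda>i. affine_coord l (pentagram_map v i))"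
    and "\<And>i j. Some (a (i, j)) = gt (i + 3 * j) ((i + j) mod 2)"
    and "\<And>i j. a (i, j) \<noteq> 0"
  shows "(\<forall>i j.
            Some (a (i, j)) = g ((i + 3 * j + (i + j) mod 2) div 2) ((- i - 3 * j + (i + j) mod 2) div 2) \<and>
            Some (a (i, j)) = (if (i + j) mod 2 = 0 then u ((i + 3 * j) div 2)
                               else Tu ((i + 3 * j - 1) div 2)) \<and>
            a (i + 3, j - 1) = a (i, j)) \<and>
         (\<forall>i j p q. i + j \<ge> 1 \<and> p + 3 * q = i - j \<longrightarrow>
            Some (a (p, q)) = gt (i - j) ((i - j) mod 2) \<and>
            Some (a (p, q)) = g ((i - j + (i - j) mod 2) div 2) ((- (i - j) + (i - j) mod 2) div 2) \<and>
            Some (a (p, q)) = (if (i - j) mod 2 = 0 then u ((i - j) div 2)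
                               else Tu ((i - j - 1) div 2)) \<and>
            (\<forall>\<phi>. kasteleyn_orientation (nat (i + j - 1)) (p, q) \<phi> \<and>
                 dimer_Z (nat (i + j - 1)) (p, q) a \<phi> \<noteq> 0 \<and>
                 has_affine_coord l (f i j) \<longrightarrow>
                 g i j = Some (dimer_Y (nat (i + j - 1)) (p, q) a \<phi>)))"
proof -
  note f = assms(1) and l = assms(2) and a = assms(8) and nz = assms(9)
  have gt_g: "gt m r = g ((m + r) div 2) ((- m + r) div 2)" for m r
    unfolding assms(3,4) tilde_def by (simp add: add.commute)
  have v: "v i = tilde f (2 * i) 0" for i by (simp add: assms(5) initial_polygon_def)
  have T: "pentagram_map v i = tilde f (2 * i + 1) 1" for i
  proof -
    have "even (2 * i + 1 + (1 :: int))" by simp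
    from f[unfolded pentagram_lattice_map_def, rule_format, OF this]
    have "line_through (v (i - 1)) (v (i + 1)) \<inter> line_through (v i) (v (i + 2)) = {tilde f (2 * i + 1) 1}"
      by (simp add: v algebra_simps)
    then show ?thesis by (simp add: pentagram_map_def)
  qed
  have gt_u: "gt m (m mod 2) = (if m mod 2 = 0 then u (m div 2) else Tu ((m - 1) div 2))" for m
  proof (cases "even m")
    case True
    then show ?thesis by (auto simp: assms(4,6) v elim!: evenE)
  next
    case False
    then show ?thesis by (auto simp: assms(4,7) T elim!: oddE)
  qed
  have mod3: "(x + 3 * y) mod 2 = (x + y) mod 2" for x y :: int by presburger
  \<comment> \<open>The label depends on \<open>x + 3 * y\<close> only; this gives both the
    periodicity and the free choice of the centre.\<close>
  have lab: "Some (a (x, y)) = gt m (m mod 2)" if "x + 3 * y = m" for x y m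
    using a[of x y] that mod3[of x y] by simp
  have lab2: "Some (a (x, y)) = g ((m + m mod 2) div 2) ((- m + m mod 2) div 2)"
    "Some (a (x, y)) = (if m mod 2 = 0 then u (m div 2) else Tu ((m - 1) div 2))"
    if "x + 3 * y = m" for x y m
    using lab[OF that] gt_g[of m "m mod 2"] gt_u[of m] by simp_all
  define V where "V i = rep_rp2 (tilde f (2 * i) 0)" for i
  have lift: "\<exists>c\<noteq>0. rep_rp2 (tilde f m (int n)) = c *\<^sub>R pentagram_lift V n m" if "even (m + int n)" for m n
    by (rule pentagram_lift_tilde[OF f V_def that])
  have coord: "affine_coord l (tilde f m (int n)) = (if pentagram_lift V n m $ 2 = 0 then None
      else Some (pentagram_lift V n m $ l / pentagram_lift V n m $ 2))" if "even (m + int n)" for m n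
    using lift[OF that] by (auto simp: affine_coord_rep)
  \<comment> \<open>Labels are finite by assumption, which yields nonzero denominators at the levels
    0 and 1.\<close>
  have level: "pentagram_lift V n m $ 2 \<noteq> 0 \<and> a (x, y) = pentagram_lift V n m $ l / pentagram_lift V n m $ 2"
    if "x + 3 * y = m" "m mod 2 = int n" for x y m n
  proof -
    have "even (m + int n)" using that(2) by presburger
    then show ?thesis
      using lab[OF that(1)] coord[of m n] that(2) by (simp add: assms(4) split: if_splits)
  qed
  have main: "g i j = Some (dimer_Y k (p, q) a \<phi>)"
    if ij: "i + j \<ge> 1" and pq: "p + 3 * q = i - j" and k: "k = nat (i + j - 1)"
      and \<phi>: "kasteleyn_orientation k (p, q) \<phi>" and Z: "dimer_Z k (p, q) a \<phi> \<noteq> 0"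
      and aff: "has_affine_coord l (f i j)" for i j p q k \<phi>
  proof -
    let ?x = "pentagram_lift V (k + 1) (p + 3 * q)"
    let ?Y = "(\<Prod>d\<in>aztec_faces k (p, q). a d) * dimer_Z k (p, q) (\<lambda>d. inverse (a d)) \<phi>"
    \<comment> \<open>The initial slice occupies the levels 0 and 1, so the diamond of size
      \<open>k\<close> computes a point of level \<open>k + 1\<close>, and \<open>f i j\<close> lies
      at level \<open>i + j\<close>.\<close>
    have k1: "int (k + 1) = i + j" using k ij by simp
    have par: "even (p + q + int (k + 1))" unfolding k1 using pq by presburger
    have ratio: "?x $ l * dimer_Z k (p, q) a \<phi> = ?x $ 2 * ?Y"
    proof (rule pentagram_dimer_ratio[OF l _ _ _ _ par kasteleyn_square_orientation[OF \<phi>]])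
      show "pentagram_lift V 0 m $ 2 \<noteq> 0" if "even m" for m
        using level[of m 0 m 0] that by (simp add: even_iff_mod_2_eq_zero)
      show "pentagram_lift V 1 m $ 2 \<noteq> 0" if "odd m" for m
        using level[of m 0 m 1] that by (simp add: odd_iff_mod_2_eq_one)
      show "a (x, y) = (if even (x + y) then pentagram_lift V 0 (x + 3 * y) $ l / pentagram_lift V 0 (x + 3 * y) $ 2
        else pentagram_lift V 1 (x + 3 * y) $ l / pentagram_lift V 1 (x + 3 * y) $ 2)" for x y
      proof (cases "even (x + y)")
        case True
        then have "(x + 3 * y) mod 2 = int 0" by presburger
        then show ?thesis using level[OF refl, of x y 0] True by simp
      next
        case False
        then have "(x + 3 * y) mod 2 = int 1" by presburger
        then show ?thesis unfolding if_not_P[OF False] using level[OF refl, of x y 1] by blast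
      qed
      show "a d \<noteq> 0" for d using nz[of "fst d" "snd d"] by simp
    qed
    have fij: "tilde f (p + 3 * q) (int (k + 1)) = f i j"
      unfolding k1 pq tilde_def by simp
    have par3: "even (p + 3 * q + int (k + 1))" using par by presburger
    \<comment> \<open>That \<open>g i j\<close> is finite is derived: since the dimer sum is
      nonzero, a zero denominator would force a zero numerator, and the affine coordinate would be
      undefined.\<close>
    have "?x $ 2 \<noteq> 0"
    proof
      assume "?x $ 2 = 0"
      moreover from this have "?x $ l = 0" using ratio Z by simp
      ultimately show False using lift[OF par3] aff unfolding fij has_affine_coord_rep by auto
    qed
    then show ?thesis
      using coord[OF par3] ratio Z unfolding fij
      by (simp add: assms(3) dimer_Y_eq field_simps del: pentagram_lift.simps)
  qed
  have period: "a (i + 3, j - 1) = a (i, j)" for i j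
    using lab[of "i + 3" "j - 1" "i + 3 * j"] lab[of i j "i + 3 * j"] by simp (metis option.inject)
  have initial: "Some (a (i, j)) = g ((i + 3 * j + (i + j) mod 2) div 2) ((- i - 3 * j + (i + j) mod 2) div 2)"
    "Some (a (i, j)) = (if (i + j) mod 2 = 0 then u ((i + 3 * j) div 2) else Tu ((i + 3 * j - 1) div 2))" for i j
    using lab2[of i j "i + 3 * j"] unfolding mod3 by simp_all
  show ?thesis
  proof (intro conjI allI impI, goal_cases)
    case (1 i j) show ?case by (rule initial(1))
  next
    case (2 i j) show ?case by (rule initial(2))
  next
    case (3 i j) show ?case by (rule period)
  next
    case (4 i j p q) then show ?case by (intro lab) (rule conjunct2)
  next
    case (5 i j p q) then show ?case by (intro lab2(1)) (rule conjunct2)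
  next
    case (6 i j p q) then show ?case by (intro lab2(2)) (rule conjunct2)
  next
    case (7 i j p q \<phi>)
    then show ?case by (elim conjE) (rule main[OF _ _ refl])
  qed
qed

end
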